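(* Let initial data $(\hat\rho_k,\hat u_k)$ with values in $D$, $k=1,\dots,d$, be given and let $(\rho_k,u_k)_{k=1,\dots,d}$ be a solution to the generalized Riemann problem or to the generalized Cauchy problem with these initial data. Let $(\bar\rho_k,\bar u_k)=(\rho_k,u_k)(t,0+)$ denote the traces at the junction. Then, for a.e. $t>0$, $$\sum_{k=1}^dA_k\,G_S(\bar\rho_k,\bar u_k)\le0$$ for every convex $S\colon\mathbb R\to\mathbb R$ with $S(v)=S(-v)$ for all $v\in\mathbb R$.
   Context: Let $\kappa>0$, $1<\gamma<3$, $\theta=\frac{\gamma-1}2$, $a_\gamma=\frac{2\sqrt{\gamma\kappa}}{\gamma-1}$, $d\in\mathbb N$, $A_1,\dots,A_d>0$, and $D=\{(x_0,x_1)\in\mathbb R^2:x_0>0\text{ or }x_0=x_1=0\}$. The isentropic gas equations are $\partial_t\rho+\partial_x(\rho u)=0$, $\partial_t(\rho u)+\partial_x(\rho u^2+\kappa\rho^\gamma)=0$, with eigenvalues $\lambda_1=u-\sqrt{\kappa\gamma}\rho^\theta$, $\lambda_2=u+\sqrt{\kappa\gamma}\rho^\theta$. Entropies: with $\lambda=\frac1{\gamma-1}-\frac12$, $J_\lambda=\int_{-1}^1(1-z^2)^\lambda\mathrm{d}z$, $c_{\gamma,\kappa}=a_\gamma^{-2/(\gamma-1)}/J_\lambda$, $\chi(\rho,\xi)=c_{\gamma,\kappa}(a_\gamma^2\rho^{\gamma-1}-\xi^2)_+^\lambda$, each convex $S\colon\mathbb R\to\mathbb R$ defines $\eta_S(\rho,u)=\int_{\mathbb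 R}\chi(\rho,v-u)S(v)\,\mathrm{d}v$, $G_S(\rho,u)=\int_{\mathbb R}[(1-\theta)u+\theta v]\chi(\rho,v-u)S(v)\,\mathrm{d}v$. A weak entropy solution is a (bounded) weak solution with $\partial_t\eta_S(\rho,u)+\partial_xG_S(\rho,u)\le0$ in the sense of distributions for all these pairs. Lax solution of the standard Riemann problem. $\mathcal{RP}(\rho_l,u_l,\rho_r,u_r)(x/t)$ denotes the self-similar weak entropy solution in the sense of Lax with data $(\rho_l,u_l)$ for $x<0$, $(\rho_r,u_r)$ for $x>0$: a 1-wave (1-rarefaction or 1-shock) followed by a 2-wave (2-rarefaction or 2-shock), with rarefactions to/from vacuum $(0,0)$ if vacuum occurs. For $(\rho_b,u_b)\in D$, $\mathcal V(\rho_b,u_b)$ is the set of states $(\rho,u)\in D$ with $(\rho,u)=\mathcal{RP}(\rho_b,u_b,\rho_r,u_r)(0+)$ for some $(\rho_r,u_r)\in D$. Generalized Riemann problem: $(\rho_k,u_k)\colon(0,\infty)_t\times(0,\infty)_x\to D$, $k=1,\dots,d$, is a solution with constant initial data $(\hat\rho_k,\hat u_k)\in D$ if $(\rho_k,u_k)(0+,x)=(\hat\rho_k,\hat u_k)$ for all $x>0$; there is $\rho_*\ge0$, independent of $k$, such that each $(\rho_k,u_k)$ is the restriction to $x>0$ of the Lax solution of the standard Riemann problem with data $(\rho_*,0)$ for $x<0$ and $(\hat\rho_k,\hat u_k)$ for $x>0$; and $\sum_kA_k\bar\rho_k\bar u_k=0$. Generalized Cauchy problem: let $U^0\in D^d$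 be a constant vector of states (in conserved variables $(\rho,\rho u)$), $\hat U=(\hat\rho_1,\hat\rho_1\hat u_1,\dots,\hat\rho_d,\hat\rho_d\hat u_d)\in U^0+L^1(0,\infty)_x$ with $(\hat\rho_k,\hat\rho_k\hat u_k)\in D$ a.e., and $T\in(0,\infty]$. $(\rho_1,\rho_1u_1,\dots,\rho_d,\rho_du_d)\in C([0,T]_t,U^0+L^1(0,\infty)_x)$ is a solution with initial data $\hat U$ if each $(\rho_k,\rho_ku_k)$ is a weak entropy solution to the isentropic gas equations on $x>0$ and: (CP0) $(\rho_k,u_k)(0+,x)=(\hat\rho_k,\hat u_k)(x)$ for a.e. $x>0$; (CP1) for a.e. $t$ there is $\rho_*(t)\ge0$ such that the traces $(\bar\rho_k,\bar u_k)(t)=(\rho_k,u_k)(t,0+)$ (assumed to exist) satisfy $(\bar\rho_k,\bar u_k)(t)\in\mathcal V(\rho_*(t),0)$ for all $k$; (CP2) $\sum_{k=1}^dA_k\bar\rho_k\bar u_k=0$ for a.e. $t$. (In the Cauchy case, "a.e. $t>0$" means a.e. $t$ in the existence interval.) *)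

theory Defs
  imports "HOL-Analysis.Analysis"
begin

text \<open>States are pairs in the primitive variables (density, velocity) unless stated otherwise.\<close>

definition state_space :: "(real \<times> real) set" where
  "state_space = {(r, m). r > 0 \<or> (r = 0 \<and> m = 0)}"

definition conserved :: "real \<times> real \<Rightarrow> real \<times> real" where
  "conserved = (\<lambda>(\<rho>, u). (\<rho>, \<rho> * u))"

definition theta :: "real \<Rightarrow> real" where
  "theta \<gamma> = (\<gamma> - 1) / 2"

definition a_const :: "real \<Rightarrow> real \<Rightarrow> real" where
  "a_const \<kappa> \<gamma> = 2 * sqrt (\<gamma> * \<kappa>) / (\<gamma> - 1)"

definition eigenvalue1 :: "real \<Rightarrow> real \<Rightarrow> real \<times> real \<Rightarrow> real" where
  "eigenvalue1 \<kappa> \<gamma> = (\<lambda>(\<rho>, u). u - sqrt (\<kappa> * \<gamma>) * \<rho> powr theta \<gamma>)"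

definition eigenvalue2 :: "real \<Rightarrow> real \<Rightarrow> real \<times> real \<Rightarrow> real" where
  "eigenvalue2 \<kappa> \<gamma> = (\<lambda>(\<rho>, u). u + sqrt (\<kappa> * \<gamma>) * \<rho> powr theta \<gamma>)"

definition momentum_flux :: "real \<Rightarrow> real \<Rightarrow> real \<times> real \<Rightarrow> real" where
  "momentum_flux \<kappa> \<gamma> = (\<lambda>(\<rho>, u). \<rho> * u\<^sup>2 + \<kappa> * \<rho> powr \<gamma>)"


definition lambda_exp :: "real \<Rightarrow> real" where
  "lambda_exp \<gamma> = 1 / (\<gamma> - 1) - 1 / 2"

definition J_const :: "real \<Rightarrow> real" where
  "J_const l = (LBINT z:{-1..1}. (1 - z\<^sup>2) powr l)"

definition c_const :: "real \<Rightarrow> real \<Rightarrow> real" where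
  "c_const \<kappa> \<gamma> = a_const \<kappa> \<gamma> powr (- 2 / (\<gamma> - 1)) / J_const (lambda_exp \<gamma>)"

definition chi :: "real \<Rightarrow> real \<Rightarrow> real \<Rightarrow> real \<Rightarrow> real" where
  "chi \<kappa> \<gamma> \<rho> \<xi> = c_const \<kappa> \<gamma> *
     (max 0 ((a_const \<kappa> \<gamma>)\<^sup>2 * \<rho> powr (\<gamma> - 1) - \<xi>\<^sup>2)) powr lambda_exp \<gamma>"

definition entropy :: "real \<Rightarrow> real \<Rightarrow> (real \<Rightarrow> real) \<Rightarrow> real \<times> real \<Rightarrow> real" where
  "entropy \<kappa> \<gamma> S = (\<lambda>(\<rho>, u). LBINT v. chi \<kappa> \<gamma> \<rho> (v - u) * S v)"

definition entropy_flux :: "real \<Rightarrow> real \<Rightarrow> (real \<Rightarrow> real) \<Rightarrow> real \<times> real \<Rightarrow> real" where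
  "entropy_flux \<kappa> \<gamma> S = (\<lambda>(\<rho>, u).
     LBINT v. ((1 - theta \<gamma>) * u + theta \<gamma> * v) * chi \<kappa> \<gamma> \<rho> (v - u) * S v)"


text \<open>A test function on an open set of the \<open>(t, x)\<close>-plane (smooth, with compact support),
  given together with all its partial derivatives: \<open>\<phi> i j\<close> is
  the \<open>i\<close>-th derivative in \<open>t\<close> and \<open>j\<close>-th derivative in \<open>x\<close> of \<open>\<phi> 0 0\<close>.\<close>

definition test_function ::
    "(real \<times> real) set \<Rightarrow> (nat \<Rightarrow> nat \<Rightarrow> real \<times> real \<Rightarrow> real) \<Rightarrow> bool" where
  "test_function \<Omega> \<phi> \<longleftrightarrow>
     (\<forall>i j p. (\<phi> i j has_derivative
        (\<lambda>h. fst h * \<phi> (Suc i) j p + snd h * \<phi> i (Suc j) p)) (at p)) \<and>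
     compact (closure {p. \<phi> 0 0 p \<noteq> 0}) \<and> closure {p. \<phi> 0 0 p \<noteq> 0} \<subseteq> \<Omega>"

text \<open>Boundedness refers to density and velocity. Together with measurability it makes all
  integrands below integrable.\<close>

definition weak_solution ::
    "real \<Rightarrow> real \<Rightarrow> (real \<times> real) set \<Rightarrow> (real \<times> real \<Rightarrow> real \<times> real) \<Rightarrow> bool" where
  "weak_solution \<kappa> \<gamma> \<Omega> U \<longleftrightarrow>
     U \<in> borel_measurable (lebesgue_on \<Omega>) \<and>
     (AE p in lebesgue_on \<Omega>. U p \<in> state_space) \<and>
     (\<exists>M. AE p in lebesgue_on \<Omega>. norm (U p) \<le> M) \<and>
     (\<forall>\<phi>. test_function \<Omega> \<phi> \<longrightarrow>
        (LINT p|lebesgue_on \<Omega>.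
           fst (conserved (U p)) * \<phi> 1 0 p + snd (conserved (U p)) * \<phi> 0 1 p) = 0 \<and>
        (LINT p|lebesgue_on \<Omega>.
           snd (conserved (U p)) * \<phi> 1 0 p + momentum_flux \<kappa> \<gamma> (U p) * \<phi> 0 1 p) = 0)"

definition weak_entropy_solution ::
    "real \<Rightarrow> real \<Rightarrow> (real \<times> real) set \<Rightarrow> (real \<times> real \<Rightarrow> real \<times> real) \<Rightarrow> bool" where
  "weak_entropy_solution \<kappa> \<gamma> \<Omega> U \<longleftrightarrow>
     weak_solution \<kappa> \<gamma> \<Omega> U \<and>
     (\<forall>S \<phi>. convex_on UNIV S \<and> test_function \<Omega> \<phi> \<and> (\<forall>p. \<phi> 0 0 p \<ge> 0) \<longrightarrow>
        (LINT p|lebesgue_on \<Omega>.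
           entropy \<kappa> \<gamma> S (U p) * \<phi> 1 0 p + entropy_flux \<kappa> \<gamma> S (U p) * \<phi> 0 1 p) \<ge> 0)"


text \<open>Elementary waves, as conditions on a self-similar profile \<open>w\<close> as a function of
  \<open>\<xi> = x / t\<close>. A wave joins a left state to a right state and occupies the sector
  \<open>s \<le> \<xi> \<le> s'\<close>. At the end of a rarefaction that reaches vacuum, \<open>v\<close> is the limit velocity,
  whereas the vacuum state itself is \<open>(0, 0)\<close>. The values of \<open>w\<close> on the bounding rays of a
  sector are left unspecified.\<close>

definition normalize_vacuum :: "real \<times> real \<Rightarrow> real \<times> real" where
  "normalize_vacuum = (\<lambda>(\<rho>, u). if \<rho> = 0 then (0, 0) else (\<rho>, u))"

definition rarefaction1 ::
    "real \<Rightarrow> real \<Rightarrow> real \<times> real \<Rightarrow> real \<times> real \<Rightarrow> real \<Rightarrow> real \<Rightarrow> (real \<Rightarrow> real \<times> real) \<Rightarrow> bool" where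
  "rarefaction1 \<kappa> \<gamma> Ul Um s s' w \<longleftrightarrow>
     (let Z = (\<lambda>(\<rho>, u). u + a_const \<kappa> \<gamma> * \<rho> powr theta \<gamma>) in
      \<exists>\<rho>m v. 0 \<le> \<rho>m \<and> \<rho>m < fst Ul \<and> Z (\<rho>m, v) = Z Ul \<and> Um = normalize_vacuum (\<rho>m, v) \<and>
        s = eigenvalue1 \<kappa> \<gamma> Ul \<and> s' = eigenvalue1 \<kappa> \<gamma> (\<rho>m, v) \<and>
        (\<forall>\<xi>. s < \<xi> \<and> \<xi> < s' \<longrightarrow>
           fst (w \<xi>) > 0 \<and> Z (w \<xi>) = Z Ul \<and> eigenvalue1 \<kappa> \<gamma> (w \<xi>) = \<xi>))"

definition rarefaction2 ::
    "real \<Rightarrow> real \<Rightarrow> real \<times> real \<Rightarrow> real \<times> real \<Rightarrow> real \<Rightarrow> real \<Rightarrow> (real \<Rightarrow> real \<times> real) \<Rightarrow> bool" where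
  "rarefaction2 \<kappa> \<gamma> Um Ur s s' w \<longleftrightarrow>
     (let Z = (\<lambda>(\<rho>, u). u - a_const \<kappa> \<gamma> * \<rho> powr theta \<gamma>) in
      \<exists>\<rho>m v. 0 \<le> \<rho>m \<and> \<rho>m < fst Ur \<and> Z (\<rho>m, v) = Z Ur \<and> Um = normalize_vacuum (\<rho>m, v) \<and>
        s = eigenvalue2 \<kappa> \<gamma> (\<rho>m, v) \<and> s' = eigenvalue2 \<kappa> \<gamma> Ur \<and>
        (\<forall>\<xi>. s < \<xi> \<and> \<xi> < s' \<longrightarrow>
           fst (w \<xi>) > 0 \<and> Z (w \<xi>) = Z Ur \<and> eigenvalue2 \<kappa> \<gamma> (w \<xi>) = \<xi>))"

definition rankine_hugoniot ::
    "real \<Rightarrow> real \<Rightarrow> real \<times> real \<Rightarrow> real \<times> real \<Rightarrow> real \<Rightarrow> bool" where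
  "rankine_hugoniot \<kappa> \<gamma> Ul Ur s \<longleftrightarrow>
     s * (fst (conserved Ur) - fst (conserved Ul)) = snd (conserved Ur) - snd (conserved Ul) \<and>
     s * (snd (conserved Ur) - snd (conserved Ul)) =
       momentum_flux \<kappa> \<gamma> Ur - momentum_flux \<kappa> \<gamma> Ul"

definition lax_shock1 :: "real \<Rightarrow> real \<Rightarrow> real \<times> real \<Rightarrow> real \<times> real \<Rightarrow> real \<Rightarrow> bool" where
  "lax_shock1 \<kappa> \<gamma> Ul Um s \<longleftrightarrow>
     rankine_hugoniot \<kappa> \<gamma> Ul Um s \<and>
     eigenvalue1 \<kappa> \<gamma> Um < s \<and> s < eigenvalue1 \<kappa> \<gamma> Ul \<and> s < eigenvalue2 \<kappa> \<gamma> Um"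

definition lax_shock2 :: "real \<Rightarrow> real \<Rightarrow> real \<times> real \<Rightarrow> real \<times> real \<Rightarrow> real \<Rightarrow> bool" where
  "lax_shock2 \<kappa> \<gamma> Um Ur s \<longleftrightarrow>
     rankine_hugoniot \<kappa> \<gamma> Um Ur s \<and>
     eigenvalue2 \<kappa> \<gamma> Ur < s \<and> s < eigenvalue2 \<kappa> \<gamma> Um \<and> eigenvalue1 \<kappa> \<gamma> Um < s"

text \<open>The first alternative in both wave types is the wave of zero strength; its location is
  irrelevant.\<close>

definition wave1 ::
    "real \<Rightarrow> real \<Rightarrow> real \<times> real \<Rightarrow> real \<times> real \<Rightarrow> real \<Rightarrow> real \<Rightarrow> (real \<Rightarrow> real \<times> real) \<Rightarrow> bool" where
  "wave1 \<kappa> \<gamma> Ul Um s s' w \<longleftrightarrow>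
     (Ul = Um \<and> s = s') \<or> (lax_shock1 \<kappa> \<gamma> Ul Um s \<and> s = s') \<or> rarefaction1 \<kappa> \<gamma> Ul Um s s' w"

definition wave2 ::
    "real \<Rightarrow> real \<Rightarrow> real \<times> real \<Rightarrow> real \<times> real \<Rightarrow> real \<Rightarrow> real \<Rightarrow> (real \<Rightarrow> real \<times> real) \<Rightarrow> bool" where
  "wave2 \<kappa> \<gamma> Um Ur s s' w \<longleftrightarrow>
     (Um = Ur \<and> s = s') \<or> (lax_shock2 \<kappa> \<gamma> Um Ur s \<and> s = s') \<or> rarefaction2 \<kappa> \<gamma> Um Ur s s' w"

text \<open>\<open>w\<close> is the profile of the Lax solution of the standard Riemann problem with data
  \<open>Ul\<close>, \<open>Ur\<close>; it is determined up to its values on finitely many rays.\<close>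

definition lax_solution ::
    "real \<Rightarrow> real \<Rightarrow> real \<times> real \<Rightarrow> real \<times> real \<Rightarrow> (real \<Rightarrow> real \<times> real) \<Rightarrow> bool" where
  "lax_solution \<kappa> \<gamma> Ul Ur w \<longleftrightarrow>
     weak_entropy_solution \<kappa> \<gamma> ({0<..} \<times> UNIV) (\<lambda>(t, x). w (x / t)) \<and>
     (\<exists>Um\<in>state_space. \<exists>s1 s1' s2 s2'.
        s1 \<le> s1' \<and> s1' \<le> s2 \<and> s2 \<le> s2' \<and>
        wave1 \<kappa> \<gamma> Ul Um s1 s1' w \<and> wave2 \<kappa> \<gamma> Um Ur s2 s2' w \<and>
        (\<forall>\<xi>. \<xi> < s1 \<longrightarrow> w \<xi> = Ul) \<and>
        (\<forall>\<xi>. s1' < \<xi> \<and> \<xi> < s2 \<longrightarrow> w \<xi> = Um) \<and>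
        (\<forall>\<xi>. s2' < \<xi> \<longrightarrow> w \<xi> = Ur))"

text \<open>The trace at \<open>0+\<close> is the essential one-sided limit, so that it does not depend on the
  representative.\<close>

definition has_trace :: "(real \<Rightarrow> real \<times> real) \<Rightarrow> real \<times> real \<Rightarrow> bool" where
  "has_trace f l \<longleftrightarrow>
     (\<forall>\<epsilon>>0. \<exists>\<delta>>0. AE x in lebesgue. 0 < x \<and> x < \<delta> \<longrightarrow> dist (f x) l < \<epsilon>)"

definition trace0 :: "(real \<Rightarrow> real \<times> real) \<Rightarrow> real \<times> real" where
  "trace0 f = (THE l. has_trace f l)"

definition boundary_states :: "real \<Rightarrow> real \<Rightarrow> real \<times> real \<Rightarrow> (real \<times> real) set" where
  "boundary_states \<kappa> \<gamma> Ub =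
     {U \<in> state_space. \<exists>Ur\<in>state_space. \<exists>w. lax_solution \<kappa> \<gamma> Ub Ur w \<and> has_trace w U}"


text \<open>\<open>U k t x\<close> is the state (density, velocity) at time \<open>t\<close> and position \<open>x\<close> on edge \<open>k\<close>.\<close>

definition generalized_riemann_solution ::
    "real \<Rightarrow> real \<Rightarrow> nat \<Rightarrow> (nat \<Rightarrow> real) \<Rightarrow> (nat \<Rightarrow> real \<times> real) \<Rightarrow>
     (nat \<Rightarrow> real \<Rightarrow> real \<Rightarrow> real \<times> real) \<Rightarrow> bool" where
  "generalized_riemann_solution \<kappa> \<gamma> d A Uh U \<longleftrightarrow>
     (\<forall>k\<in>{1..d}. \<forall>t>0. \<forall>x>0. U k t x \<in> state_space) \<and>
     (\<forall>k\<in>{1..d}. \<forall>x>0. ((\<lambda>t. U k t x) \<longlongrightarrow> Uh k) (at_right 0)) \<and>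
     (\<exists>\<rho>s\<ge>0. \<forall>k\<in>{1..d}. \<exists>w. lax_solution \<kappa> \<gamma> (\<rho>s, 0) (Uh k) w \<and>
        (\<forall>t>0. \<forall>x>0. U k t x = w (x / t))) \<and>
     (\<forall>t>0. (\<Sum>k=1..d. A k * snd (conserved (trace0 (U k t)))) = 0)"

definition cauchy_data ::
    "nat \<Rightarrow> (nat \<Rightarrow> real \<times> real) \<Rightarrow> (nat \<Rightarrow> real \<Rightarrow> real \<times> real) \<Rightarrow> bool" where
  "cauchy_data d U0 Uh \<longleftrightarrow>
     (\<forall>k\<in>{1..d}. U0 k \<in> state_space \<and>
        (AE x in lebesgue_on {0<..}. Uh k x \<in> state_space) \<and>
        integrable (lebesgue_on {0<..}) (\<lambda>x. conserved (Uh k x) - U0 k))"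

text \<open>\<open>U0\<close> is in conserved variables, \<open>Uh\<close> and \<open>U\<close> in primitive ones. The time interval is
  \<open>[0, T]\<close>, read as \<open>[0, \<infinity>)\<close> for \<open>T = \<infinity>\<close>. By the continuity in time with values in
  \<open>U0 + L\<^sup>1\<close>, the initial trace is the value at time \<open>0\<close>.\<close>

definition generalized_cauchy_solution ::
    "real \<Rightarrow> real \<Rightarrow> nat \<Rightarrow> (nat \<Rightarrow> real) \<Rightarrow> (nat \<Rightarrow> real \<times> real) \<Rightarrow> ereal \<Rightarrow>
     (nat \<Rightarrow> real \<Rightarrow> real \<times> real) \<Rightarrow> (nat \<Rightarrow> real \<Rightarrow> real \<Rightarrow> real \<times> real) \<Rightarrow> bool" where
  "generalized_cauchy_solution \<kappa> \<gamma> d A U0 T Uh U \<longleftrightarrow>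
     (let I = {t. 0 \<le> t \<and> ereal t \<le> T} in
      (\<forall>k\<in>{1..d}.
         (\<forall>t\<in>I. integrable (lebesgue_on {0<..}) (\<lambda>x. conserved (U k t x) - U0 k)) \<and>
         (\<forall>s\<in>I. ((\<lambda>t. LINT x|lebesgue_on {0<..}.
            norm (conserved (U k t x) - conserved (U k s x))) \<longlongrightarrow> 0) (at s within I)) \<and>
         weak_entropy_solution \<kappa> \<gamma> ({t. 0 < t \<and> ereal t < T} \<times> {0<..}) (\<lambda>(t, x). U k t x) \<and>
         (AE x in lebesgue_on {0<..}. U k 0 x = Uh k x)) \<and>
      (AE t in lebesgue. 0 < t \<and> ereal t < T \<longrightarrow>
         (\<forall>k\<in>{1..d}. \<exists>l. has_trace (U k t) l) \<and>
         (\<exists>\<rho>s\<ge>0. \<forall>k\<in>{1..d}. trace0 (U k t) \<in> boundary_states \<kappa> \<gamma> (\<rho>s, 0))) \<and>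
      (AE t in lebesgue. 0 < t \<and> ereal t < T \<longrightarrow>
         (\<Sum>k=1..d. A k * snd (conserved (trace0 (U k t)))) = 0))"

end

theory Submission
  imports Defs
begin

text \<open>
  Let \<open>\<rho>\<^sub>*\<close> be the density behind the junction. For even convex \<open>S\<close> the entropy satisfies
  \<open>\<eta>\<^sub>S(\<rho>, u) \<ge> \<eta>\<^sub>S(\<rho>, 0)\<close>, and \<open>\<rho> \<mapsto> \<eta>\<^sub>S(\<rho>, 0)\<close> is an average of the functions
  \<open>\<rho> S(a \<rho>\<^sup>\<theta> z)\<close>, which are convex in \<open>\<rho>\<close>. Hence there is a slope \<open>c\<close>, depending only on \<open>S\<close> and
  \<open>\<rho>\<^sub>*\<close>, such that the relative entropy
  \<open>E = \<eta>\<^sub>S - \<eta>\<^sub>S(\<rho>\<^sub>*, 0) - c (\<rho> - \<rho>\<^sub>*)\<close> is nonnegative; its flux is \<open>Q = G\<^sub>S - c \<rho> u\<close>, and both vanish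
  at \<open>(\<rho>\<^sub>*, 0)\<close>. Integrating \<open>E\<^sub>t + Q\<^sub>x \<le> 0\<close> for a self-similar solution over \<open>x < 0\<close> gives
  \<open>Q(0+) \<le> - \<integral> E d\<xi> \<le> 0\<close>, that is \<open>G\<^sub>S \<le> c \<rho> u\<close> at the junction. Since \<open>c\<close> is the same on all
  edges, conservation of mass at the junction gives the claim.
\<close>

subsection \<open>A smooth step function\<close>

text \<open>The slope may act on the density only, because the junction supplies a balance for mass
  and none for momentum. Evenness of \<open>S\<close> permits this: the entropy is minimal in the
  velocity at rest, so its supporting plane there has no momentum component. Subtracting multiples
  of the mass equation and a constant keeps the entropy inequality, since both satisfy exact
  conservation laws. Lax solutions are weak entropy solutions by definition, so no shock or
  rarefaction is evaluated for the inequality; of the wave pattern it uses only that the state is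
  constant far to the left. The fans enter solely to show that a trace exists in the Riemann
  problem. The remaining difficulty is to pass from a distributional inequality to one at x/t = 0+.
  It requires cutoffs with derivatives of every order, as \<open>test_function\<close> demands, and
  a Borel version of the profile, since the solution is only Lebesgue measurable in (t, x) and its
  values on null sets are arbitrary.\<close>

primrec times_differentiable :: "nat \<Rightarrow> (real \<Rightarrow> real) \<Rightarrow> bool" where
  "times_differentiable 0 f \<longleftrightarrow> True"
| "times_differentiable (Suc n) f \<longleftrightarrow>
     (\<exists>g. (\<forall>x. (f has_real_derivative g x) (at x)) \<and> times_differentiable n g)"

text \<open>Smoothness is split into finite orders so that closure under products is an induction on
  the order; afterwards \<open>deriv\<close> selects the derivatives, which are unique.\<close>

definition smooth :: "(real \<Rightarrow> real) \<Rightarrow> bool" where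
  "smooth f \<longleftrightarrow> (\<forall>n. times_differentiable n f)"

lemma times_differentiable_SucD: "times_differentiable (Suc n) f \<Longrightarrow> times_differentiable n f"
proof (induction n arbitrary: f)
  case (Suc n)
  then show ?case by (metis times_differentiable.simps(2))
qed simp

lemma times_differentiable_const: "times_differentiable n (\<lambda>x. c)"
proof (induction n arbitrary: c)
  case (Suc n)
  then show ?case by (auto intro!: exI[of _ "\<lambda>x. 0"])
qed simp

lemma times_differentiable_add:
  "times_differentiable n f \<Longrightarrow> times_differentiable n g \<Longrightarrow> times_differentiable n (\<lambda>x. f x + g x)"
proof (induction n arbitrary: f g)
  case (Suc n)
  then obtain f' g' where "\<forall>x. (f has_real_derivative f' x) (at x)" "times_differentiable n f'"
    "\<forall>x. (g has_real_derivative g' x) (at x)" "times_differentiable n g'" by auto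
  with Suc.IH show ?case
    by (auto intro!: exI[of _ "\<lambda>x. f' x + g' x"] derivative_eq_intros)
qed simp

lemma times_differentiable_mult:
  "times_differentiable n f \<Longrightarrow> times_differentiable n g \<Longrightarrow> times_differentiable n (\<lambda>x. f x * g x)"
proof (induction n arbitrary: f g)
  case (Suc n)
  then obtain f' g' where d: "\<And>x. (f has_real_derivative f' x) (at x)" "times_differentiable n f'"
    "\<And>x. (g has_real_derivative g' x) (at x)" "times_differentiable n g'" by auto
  have "times_differentiable n (\<lambda>x. f' x * g x + f x * g' x)"
    by (rule times_differentiable_add[OF Suc.IH Suc.IH])
      (use Suc.prems[THEN times_differentiable_SucD] d in auto)
  moreover have "((\<lambda>x. f x * g x) has_real_derivative f' x * g x + f x * g' x) (at x)" for x
    by (auto intro!: derivative_eq_intros d)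
  ultimately show ?case
    unfolding times_differentiable.simps by (intro exI[of _ "\<lambda>x. f' x * g x + f x * g' x"]) simp
qed simp

lemma times_differentiable_reflect:
  "times_differentiable n f \<Longrightarrow> times_differentiable n (\<lambda>x. f (1 - x))"
proof (induction n arbitrary: f)
  case (Suc n)
  then obtain f' where d: "\<And>x. (f has_real_derivative f' x) (at x)" "times_differentiable n f'"
    by auto
  have "times_differentiable n (\<lambda>x. (-1) * f' (1 - x))"
    by (rule times_differentiable_mult[OF times_differentiable_const Suc.IH[OF d(2)]])
  moreover have "((\<lambda>x. f (1 - x)) has_real_derivative (-1) * f' (1 - x)) (at x)" for x
    by (rule DERIV_chain'[OF _ d(1), THEN DERIV_cong]) (auto intro!: derivative_eq_intros)
  ultimately show ?case
    unfolding times_differentiable.simps by (intro exI[of _ "\<lambda>x. (-1) * f' (1 - x)"]) simp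
qed simp

lemma smooth_has_derivative:
  assumes "smooth f"
  shows "(f has_real_derivative deriv f x) (at x)" and "smooth (deriv f)"
proof -
  have d: "(f has_real_derivative g x) (at x) \<Longrightarrow> deriv f x = g x" for g x
    by (rule DERIV_imp_deriv)
  from assms have "times_differentiable (Suc 0) f" by (simp only: smooth_def)
  then show "(f has_real_derivative deriv f x) (at x)" using d by (metis times_differentiable.simps(2))
  show "smooth (deriv f)"
    unfolding smooth_def
  proof
    fix n
    from assms have "times_differentiable (Suc n) f" by (simp only: smooth_def)
    then obtain g where g: "\<forall>x. (f has_real_derivative g x) (at x)" "times_differentiable n g"
      by auto
    then have "deriv f = g" using d by blast
    with g show "times_differentiable n (deriv f)" by simp
  qed
qed

lemma smooth_iterated_deriv:
  assumes "smooth f"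
  shows "((deriv ^^ n) f has_real_derivative (deriv ^^ Suc n) f x) (at x)"
proof -
  have "smooth ((deriv ^^ n) f)"
    by (induction n) (auto intro: assms smooth_has_derivative)
  then show ?thesis by (simp add: smooth_has_derivative)
qed

text \<open>exp(-1/x) times powers of 1/x, extended by 0. The span of the family is closed under
  differentiation, and the difference quotient of \<open>flat n\<close> at 0 is
  \<open>flat (Suc n)\<close>, so a single limit at 0 settles all orders.\<close>

definition flat :: "nat \<Rightarrow> real \<Rightarrow> real" where
  "flat n x = (if x > 0 then exp (- inverse x) * inverse x ^ n else 0)"

lemma flat_tendsto_0: "(flat n \<longlongrightarrow> 0) (at_right 0)"
proof -
  have "((\<lambda>y::real. y ^ n / exp y) \<longlongrightarrow> 0) at_top"
    by (rule tendsto_power_div_exp_0)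
  then have "((\<lambda>x::real. inverse x ^ n / exp (inverse x)) \<longlongrightarrow> 0) (at_right 0)"
    by (rule filterlim_compose[OF _ filterlim_inverse_at_top_right])
  then show ?thesis
    by (rule Lim_transform_eventually)
      (auto simp: eventually_at_right_field flat_def exp_minus field_simps intro!: exI[of _ 1])
qed

lemma flat_has_derivative:
  "(flat n has_real_derivative flat (Suc (Suc n)) x - real n * flat (Suc n) x) (at x)"
proof (cases x "0 :: real" rule: linorder_cases)
  case less
  have "((\<lambda>_. 0) has_real_derivative 0) (at x)" by simp
  then have "(flat n has_real_derivative 0) (at x)"
    by (rule has_field_derivative_transform_within_open[where S = "{..<0}"])
      (use less in \<open>auto simp: flat_def\<close>)
  with less show ?thesis by (simp add: flat_def)
next
  case equal
  have "((\<lambda>h. (flat n (0 + h) - flat n 0) / h) \<longlongrightarrow> 0) (at 0)"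
    unfolding filterlim_at_split
  proof
    show "((\<lambda>h. (flat n (0 + h) - flat n 0) / h) \<longlongrightarrow> 0) (at_left 0)"
      by (rule tendsto_eventually) (auto simp: eventually_at_left_field flat_def intro!: exI[of _ "-1"])
    show "((\<lambda>h. (flat n (0 + h) - flat n 0) / h) \<longlongrightarrow> 0) (at_right 0)"
      by (rule Lim_transform_eventually[OF flat_tendsto_0[of "Suc n"]])
        (auto simp: eventually_at_right_field flat_def field_simps intro!: exI[of _ "1"])
  qed
  then show ?thesis by (simp add: DERIV_def equal flat_def)
next
  case greater
  have "((\<lambda>x. exp (- inverse x) * inverse x ^ n) has_real_derivative
    flat (Suc (Suc n)) x - real n * flat (Suc n) x) (at x)"
  proof (cases n)
    case 0
    with greater show ?thesis
      by (auto intro!: derivative_eq_intros simp: flat_def power2_eq_square)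
  next
    case (Suc m)
    then have "inverse x ^ n = inverse x * inverse x ^ (n - 1)" by simp
    with greater show ?thesis
      by (auto intro!: derivative_eq_intros simp: flat_def power2_eq_square algebra_simps)
  qed
  then show ?thesis
    by (rule has_field_derivative_transform_within_open[where S = "{0<..}"])
      (use greater in \<open>auto simp: flat_def\<close>)
qed

lemma smooth_flat: "smooth (flat 0)"
proof -
  have "times_differentiable k (flat n)" for k n
  proof (induction k arbitrary: n)
    case (Suc k)
    have "times_differentiable k (\<lambda>x. flat (Suc (Suc n)) x + (- real n) * flat (Suc n) x)"
      by (intro times_differentiable_add times_differentiable_mult times_differentiable_const Suc.IH)
    with flat_has_derivative[of n] show ?case
      unfolding times_differentiable.simps
      by (intro exI[of _ "\<lambda>x. flat (Suc (Suc n)) x - real n * flat (Suc n) x"]) simp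
  qed simp
  then show ?thesis by (simp add: smooth_def)
qed

text \<open>The step is the normalised primitive of a bump supported in the unit interval, and
  \<open>B n\<close> is its n-th derivative.\<close>

lemma smooth_step_exists:
  obtains B :: "nat \<Rightarrow> real \<Rightarrow> real"
  where "\<And>n x. (B n has_real_derivative B (Suc n) x) (at x)"
    and "\<And>x. x \<le> 0 \<Longrightarrow> B 0 x = 0" and "\<And>x. x \<ge> 1 \<Longrightarrow> B 0 x = 1"
    and "\<And>x. 0 \<le> B 0 x" and "\<And>x. B 0 x \<le> 1" and "\<And>x. 0 \<le> B 1 x"
    and "\<And>n x. x \<notin> {0..1} \<Longrightarrow> B (Suc n) x = 0"
proof -
  define b where "b x = flat 0 x * flat 0 (1 - x)" for x
  have sb: "smooth b"
    using smooth_flat unfolding smooth_def b_def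
    by (metis times_differentiable_mult times_differentiable_reflect)
  have b0: "b x \<ge> 0" and bz: "x \<notin> {0<..<1} \<Longrightarrow> b x = 0" for x
    by (auto simp: b_def flat_def)
  have cb: "continuous_on A b" for A
    using smooth_has_derivative(1)[OF sb] by (meson DERIV_continuous_on has_field_derivative_at_within)
  define F where "F x = integral {0..x} b" for x
  have int: "b integrable_on {x..y}" for x y
    by (intro integrable_continuous_interval cb)
  have Fz: "F x = 0" if "x \<le> 0" for x
  proof -
    have "integral {0..x} b = integral {0..x} (\<lambda>_. 0)"
      by (rule integral_cong) (use that bz in auto)
    then show ?thesis by (simp add: F_def)
  qed
  have Fadd: "F y - F x = integral {x..y} b" if "0 \<le> x" "x \<le> y" for x y
    unfolding F_def using Henstock_Kurzweil_Integration.integral_combine[OF that int] by simp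
  have Fmono: "F x \<le> F y" if "x \<le> y" for x y
  proof (cases "x \<ge> 0")
    case True
    then show ?thesis using Fadd[of x y] that b0 by (metis diff_ge_0_iff_ge integral_nonneg int)
  next
    case False
    have "0 \<le> F y" unfolding F_def by (intro integral_nonneg int b0)
    with False show ?thesis by (simp add: Fz)
  qed
  have F1: "F x = F 1" if "x \<ge> 1" for x
  proof -
    have "integral {1..x} b = integral {1..x} (\<lambda>_. 0)"
      by (rule integral_cong) (use that bz in auto)
    with Fadd[of 1 x] that show ?thesis by simp
  qed
  have F': "(F has_real_derivative b x) (at x)" for x
  proof -
    \<comment> \<open>A base point to the left of both 0 and x makes \<open>F\<close> a primitive
      with one fixed lower limit near x. For y < 0 this agrees with \<open>F\<close>, which is then
      an integral over an empty interval, because \<open>b\<close> vanishes there.\<close>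
    define c where "c = min 0 x - 1"
    have eq: "F y = integral {c..y} b" if "c \<le> y" for y
    proof (cases "y \<ge> 0")
      case True
      have "integral {c..0} b = integral {c..0} (\<lambda>_. 0)"
        by (rule integral_cong) (use bz in auto)
      then show ?thesis unfolding F_def
        using Henstock_Kurzweil_Integration.integral_combine[of c 0 y b] True int
        by (simp add: c_def)
    next
      case False
      have "integral {c..y} b = integral {c..y} (\<lambda>_. 0)"
        by (rule integral_cong) (use False bz in auto)
      with False show ?thesis by (simp add: Fz)
    qed
    have "((\<lambda>y. integral {c..y} b) has_real_derivative b x) (at x within {c..x + 1})"
      by (rule integral_has_real_derivative[OF cb]) (auto simp: c_def)
    then have "((\<lambda>y. integral {c..y} b) has_real_derivative b x) (at x)"
      by (subst (asm) at_within_Icc_at) (auto simp: c_def)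
    then show ?thesis
      by (rule has_field_derivative_transform_within_open[where S = "{c<..}"])
        (auto simp: c_def intro!: eq[symmetric, unfolded c_def])
  qed
  have pos: "F 1 > 0"
  proof -
    have "F 1 \<noteq> 0"
    proof
      assume "F 1 = 0"
      then have "integral (cbox 0 1) b = 0" by (simp add: F_def)
      then have "(b has_integral 0) (cbox 0 1)"
        using int[of 0 1] by (metis integrable_integral interval_cbox)
      then have "b (1/2) = 0"
        by (rule has_integral_0_cbox_imp_0[rotated 2]) (auto intro: cb b0)
      then show False by (simp add: b_def flat_def)
    qed
    moreover have "F 1 \<ge> 0" using Fmono[of 0 1] by (simp add: Fz)
    ultimately show ?thesis by simp
  qed
  define B where "B n x = (case n of 0 \<Rightarrow> F x / F 1 | Suc m \<Rightarrow> (deriv ^^ m) b x / F 1)" for n x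
  have BD: "(B n has_real_derivative B (Suc n) x) (at x)" for n x
  proof (cases n)
    case 0
    show ?thesis unfolding B_def 0 using pos by (auto intro!: derivative_eq_intros F')
  next
    case (Suc m)
    show ?thesis unfolding B_def Suc nat.case
      by (intro DERIV_cdivide smooth_iterated_deriv sb)
  qed
  have Bz: "B (Suc n) x = 0" if "x \<notin> {0..1}" for n x
    using that
  proof (induction n arbitrary: x)
    case 0
    then show ?case using bz[of x] by (auto simp: B_def)
  next
    case (Suc n)
    have op: "open (- {0..1::real})" by (simp add: open_Compl)
    have "((\<lambda>_. 0) has_real_derivative 0) (at x)" by simp
    then have "(B (Suc n) has_real_derivative 0) (at x)"
      by (rule has_field_derivative_transform_within_open[OF _ op]) (use Suc in auto)
    then show ?case using BD[of "Suc n" x] DERIV_unique by blast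
  qed
  show ?thesis
  proof
    show "(B n has_real_derivative B (Suc n) x) (at x)" for n x by (rule BD)
    show "B 0 x = 0" if "x \<le> 0" for x using that by (simp add: B_def Fz)
    show "B 0 x = 1" if "x \<ge> 1" for x
    proof -
      have "F x = F 1" by (rule F1[OF that])
      with pos show ?thesis by (simp add: B_def)
    qed
    show "0 \<le> B 0 x" for x
    proof -
      have "0 \<le> F x" unfolding F_def by (intro integral_nonneg int b0)
      with pos show ?thesis by (simp add: B_def)
    qed
    show "B 0 x \<le> 1" for x
    proof (cases "x \<le> 1")
      case True
      with Fmono pos show ?thesis by (simp add: B_def)
    next
      case False
      then have "F x = F 1" by (intro F1) simp
      with pos show ?thesis by (simp add: B_def)
    qed
    show "0 \<le> B 1 x" for x using b0[of x] pos by (simp add: B_def)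
    show "B (Suc n) x = 0" if "x \<notin> {0..1}" for n x using that by (rule Bz)
  qed
qed

subsection \<open>Convexity of the symmetric entropies\<close>

text \<open>z is the midpoint of u + z and z - u, and evenness replaces z - u by u - z. With z = 0
  it says that \<open>S\<close> is minimal at 0.\<close>

lemma even_convex_le_mean:
  fixes S :: "real \<Rightarrow> real"
  assumes "convex_on UNIV S" and "\<And>v. S v = S (- v)"
  shows "2 * S z \<le> S (u + z) + S (u - z)"
proof -
  have "S ((1 - 1/2) *\<^sub>R (u + z) + (1/2) *\<^sub>R (z - u)) \<le> (1 - 1/2) * S (u + z) + (1/2) * S (z - u)"
    by (rule convex_onD[OF assms(1)]) auto
  moreover have "(1 - 1/2) *\<^sub>R (u + z) + (1/2) *\<^sub>R (z - u) = z" by (simp add: field_simps)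
  ultimately show ?thesis using assms(2)[of "z - u"] by simp
qed

lemma even_convex_supporting_line:
  fixes S :: "real \<Rightarrow> real"
  assumes S: "convex_on UNIV S" "\<And>v. S v = S (- v)" and y: "y \<ge> 0"
  obtains p where "p \<ge> 0" and "\<And>v. S v \<ge> S y + p * (v - y)"
proof (cases "y = 0")
  case True
  have "S v \<ge> S 0 + 0 * (v - 0)" for v
    using even_convex_le_mean[OF S, of 0 v] S(2)[of v] by simp
  with True that show ?thesis by blast
next
  case False
  define p where "p = Inf ((\<lambda>t. (S y - S t) / (y - t)) ` ({y<..} \<inter> UNIV))"
  have p: "S v \<ge> S y + p * (v - y)" for v
    unfolding p_def by (rule convex_le_Inf_differential[OF S(1)]) auto
  \<comment> \<open>The supporting line at y is compared with \<open>S\<close> at -y, where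
    \<open>S\<close> takes the same value as at y.\<close>
  have "p * (- y - y) \<le> 0" using p[of "- y"] S(2)[of y] by simp
  with False y have "p \<ge> 0" by (simp add: zero_le_mult_iff)
  with p that show ?thesis by blast
qed

text \<open>\<open>S\<close> need not be differentiable, so convexity of functions built from it is
  certified by supporting lines instead of second derivatives.\<close>

lemma supporting_line_imp_convex_on:
  fixes f :: "real \<Rightarrow> real"
  assumes "convex A" and line: "\<And>x. x \<in> A \<Longrightarrow> \<exists>c. \<forall>y\<in>A. f y \<ge> f x + c * (y - x)"
  shows "convex_on A f"
proof (rule convex_onI)
  fix t x y :: real
  assume t: "t > 0" "t < 1" and xy: "x \<in> A" "y \<in> A"
  define z where "z = (1 - t) *\<^sub>R x + t *\<^sub>R y"
  have "z \<in> A" unfolding z_def using \<open>convex A\<close> t xy by (simp add: convex_alt)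
  then obtain c where c: "f x \<ge> f z + c * (x - z)" "f y \<ge> f z + c * (y - z)"
    using line xy by blast
  have "(1 - t) * f x + t * f y \<ge> (1 - t) * (f z + c * (x - z)) + t * (f z + c * (y - z))"
    using c t by (intro add_mono mult_left_mono) auto
  also have "(1 - t) * (f z + c * (x - z)) + t * (f z + c * (y - z)) = f z"
    by (simp add: z_def algebra_simps)
  finally show "f ((1 - t) *\<^sub>R x + t *\<^sub>R y) \<le> (1 - t) * f x + t * f y" by (simp add: z_def)
qed fact

lemma powr_above_tangent:
  fixes p x y :: real
  assumes "p \<ge> 1" "x \<ge> 0" "y \<ge> 0"
  shows "y powr p \<ge> x powr p + p * x powr (p - 1) * (y - x)"
proof (cases "x = 0 \<or> y = 0")
  \<comment> \<open>Convexity of the power is available on the open half line only, so the endpoints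
    are done by hand. By convention \<open>0 powr 0 = 0\<close>, so for p = 1 the slope at x = 0 is
    0, and the bound still holds.\<close>
  case True
  have "x powr p = x * x powr (p - 1)"
    using assms by (cases "x = 0") (auto simp: powr_diff)
  moreover have "x * x powr (p - 1) \<le> p * (x * x powr (p - 1))"
    using assms mult_right_mono[of 1 p "x * x powr (p - 1)"] by simp
  ultimately show ?thesis using True assms by (auto simp: algebra_simps)
next
  case False
  with assms have "x > 0" "y > 0" by auto
  have "y powr p - x powr p \<ge> p * x powr (p - 1) * (y - x)"
    by (rule convex_on_imp_above_tangent[where A = "{0<..}"])
      (use \<open>x > 0\<close> \<open>y > 0\<close> assms in
        \<open>auto intro!: powr_convex derivative_eq_intros simp: interior_open powr_diff\<close>)
  then show ?thesis by simp
qed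

text \<open>Bound \<open>S\<close> below by its supporting line at y = |b| x^\<theta> and multiply
  by r: a linear term plus p |b| r^(1+\<theta>) remains. Since p is nonnegative, the tangent of that
  convex power at x yields a supporting line of the whole function.\<close>

lemma convex_on_density_times_even:
  fixes S :: "real \<Rightarrow> real"
  assumes S: "convex_on UNIV S" "\<And>v. S v = S (- v)" and "\<theta> > 0"
  shows "convex_on {0..} (\<lambda>r. r * S (b * r powr \<theta>))"
proof (rule supporting_line_imp_convex_on)
  fix x :: real assume x: "x \<in> {0..}"
  define y where "y = \<bar>b\<bar> * x powr \<theta>"
  have even: "S (b * t) = S (\<bar>b\<bar> * t)" for t
    using S(2)[of "b * t"] by (simp add: abs_if)
  obtain p where p: "p \<ge> 0" "\<And>v. S v \<ge> S y + p * (v - y)"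
    using even_convex_supporting_line[OF S, of y] by (auto simp: y_def)
  show "\<exists>c. \<forall>r\<in>{0..}. r * S (b * r powr \<theta>) \<ge> x * S (b * x powr \<theta>) + c * (r - x)"
  proof (intro exI ballI)
    fix r :: real assume r: "r \<in> {0..}"
    have pr: "t powr (1 + \<theta>) = t * t powr \<theta>" if "t \<ge> 0" for t
      using that \<open>\<theta> > 0\<close> by (cases "t = 0") (auto simp: powr_add)
    have "r * r powr \<theta> \<ge> x * x powr \<theta> + (1 + \<theta>) * x powr \<theta> * (r - x)"
      using powr_above_tangent[of "1 + \<theta>" x r] x r \<open>\<theta> > 0\<close> by (simp add: pr)
    then have "p * \<bar>b\<bar> * (r * r powr \<theta>) \<ge> p * \<bar>b\<bar> * (x * x powr \<theta> + (1 + \<theta>) * x powr \<theta> * (r - x))"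
      using p(1) by (intro mult_left_mono) auto
    moreover have "r * S (\<bar>b\<bar> * r powr \<theta>) \<ge> r * (S y + p * (\<bar>b\<bar> * r powr \<theta> - y))"
      using p(2) r by (intro mult_left_mono) auto
    \<comment> \<open>The slope collects S y - p y from the linear term and (1 + \<theta>) p y from
      the tangent of the power.\<close>
    ultimately show "r * S (b * r powr \<theta>) \<ge> x * S (b * x powr \<theta>) + (S y + \<theta> * p * y) * (r - x)"
      unfolding even[of "r powr \<theta>"] even[of "x powr \<theta>"] y_def[symmetric]
      by (simp add: y_def algebra_simps)
  qed
qed simp

lemma integral_odd_eq_0:
  fixes f :: "real \<Rightarrow> real"
  assumes "\<And>x. f (- x) = - f x"
  shows "integral {-a..a} f = 0"
proof -
  have "integral {-a..a} (\<lambda>x. f (- x)) = integral {-a..a} f"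
    using Henstock_Kurzweil_Integration.integral_reflect_real[of "a" "-a" f] by simp
  then show ?thesis using assms by simp
qed

section \<open>Kinetic formulas for the entropy and its flux\<close>

locale gas =
  fixes \<kappa> \<gamma> :: real
  assumes kappa_pos: "\<kappa> > 0" and gamma_gt_1: "1 < \<gamma>" and gamma_less_3: "\<gamma> < 3"
begin

abbreviation "\<theta> \<equiv> theta \<gamma>"
abbreviation "a \<equiv> a_const \<kappa> \<gamma>"
abbreviation "l \<equiv> lambda_exp \<gamma>"

lemma theta_pos: "\<theta> > 0"
  using gamma_gt_1 by (simp add: theta_def)

lemma a_pos: "a > 0"
  using kappa_pos gamma_gt_1 by (simp add: a_const_def)

text \<open>Here \<gamma> < 3 enters: it is equivalent to a positive exponent, which makes the
  weight continuous up to the endpoints -1 and 1.\<close>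

lemma l_pos: "l > 0"
  using gamma_gt_1 gamma_less_3 by (simp add: lambda_exp_def field_simps)

lemma c_const_nonneg: "c_const \<kappa> \<gamma> \<ge> 0"
  unfolding c_const_def J_const_def set_lebesgue_integral_def
  by (intro divide_nonneg_nonneg integral_nonneg_AE) auto

definition weight :: "real \<Rightarrow> real" where
  "weight z = (1 - z\<^sup>2) powr l"

text \<open>This is 1/J in disguise: 1/\<theta> = 2/(\<gamma> - 1) cancels the power of
  \<open>a\<close> contained in \<open>c_const\<close>.\<close>

definition scale :: real where
  "scale = c_const \<kappa> \<gamma> * a powr (1 / \<theta>)"

lemma scale_nonneg: "scale \<ge> 0"
  using c_const_nonneg by (simp add: scale_def)

lemma weight_nonneg: "weight z \<ge> 0"
  by (simp add: weight_def)

lemma weight_even: "weight (- z) = weight z"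
  by (simp add: weight_def)

lemma square_le_1: "z \<in> {-1..1} \<Longrightarrow> z\<^sup>2 \<le> 1" for z :: real
  using abs_square_le_1[of z] by auto

lemma continuous_on_weight: "continuous_on {-1..1} weight"
  unfolding weight_def
  by (intro continuous_on_powr' continuous_intros) (use l_pos square_le_1 in auto)

text \<open>Substitute v = u + s z with s = a \<rho>^\<theta>. The factor s^(1 + 2l) produced is
  a^(1/\<theta>) \<rho>, because 1 + 2l = 1/\<theta>, so the integral becomes \<rho> times a
  weighted average over the fixed interval from -1 to 1.\<close>

lemma chi_integral:
  assumes f: "continuous_on UNIV f" and "\<rho> \<ge> 0"
  shows "(LBINT v. chi \<kappa> \<gamma> \<rho> (v - u) * f v) =
    scale * \<rho> * integral {-1..1} (\<lambda>z. weight z * f (u + a * \<rho> powr \<theta> * z))"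
proof (cases "\<rho> = 0")
  case True
  have "max 0 (- x\<^sup>2) = (0 :: real)" for x :: real
    by (simp add: max_def)
  with True show ?thesis by (simp add: chi_def)
next
  case False
  define s where "s = a * \<rho> powr \<theta>"
  have s: "s > 0" using False assms a_pos by (simp add: s_def)
  have s2: "a\<^sup>2 * \<rho> powr (\<gamma> - 1) = s\<^sup>2"
    by (simp add: s_def power_mult_distrib power2_eq_square theta_def flip: powr_add)
  have sl: "s * (s\<^sup>2) powr l = a powr (1 / \<theta>) * \<rho>"
  proof -
    have "s\<^sup>2 = s powr 2" using s by simp
    then have "(s\<^sup>2) powr l = s powr (2 * l)" by (simp only: powr_powr)
    then have "s * (s\<^sup>2) powr l = s powr (1 + 2 * l)"
      using s by (simp add: powr_add)
    also have "1 + 2 * l = 1 / \<theta>"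
      by (simp add: lambda_exp_def theta_def right_diff_distrib)
    also have "s powr (1 / \<theta>) = a powr (1 / \<theta>) * \<rho>"
      using False assms a_pos theta_pos by (simp add: s_def powr_mult powr_powr)
    finally show ?thesis .
  qed
  have chi: "s * chi \<kappa> \<gamma> \<rho> (s * z) = scale * \<rho> * (indicator {-1..1} z * weight z)" for z
  proof -
    have "s\<^sup>2 - (s * z)\<^sup>2 = s\<^sup>2 * (1 - z\<^sup>2)"
      by (simp add: power_mult_distrib right_diff_distrib)
    then have "max 0 (s\<^sup>2 - (s * z)\<^sup>2) = s\<^sup>2 * max 0 (1 - z\<^sup>2)"
      by (simp add: max_mult_distrib_left)
    \<comment> \<open>The indicator is essential: for |z| > 1 the power of a negative base in
      \<open>weight\<close> is a meaningless nonzero number, whereas the kernel vanishes.\<close>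
    moreover have "max 0 (1 - z\<^sup>2) powr l = indicator {-1..1} z * weight z"
    proof (cases "z \<in> {-1..1}")
      case True
      with square_le_1[OF this] show ?thesis by (simp add: weight_def)
    next
      case False
      then have "z\<^sup>2 > 1" using abs_square_le_1[of z] by auto
      with False show ?thesis by simp
    qed
    ultimately have "s * chi \<kappa> \<gamma> \<rho> (s * z) =
        c_const \<kappa> \<gamma> * (s * (s\<^sup>2) powr l) * (indicator {-1..1} z * weight z)"
      by (simp add: chi_def s2 powr_mult)
    then show ?thesis by (simp add: sl scale_def)
  qed
  have cont: "continuous_on {-1..1} (\<lambda>z. weight z * f (u + s * z))"
    by (intro continuous_intros continuous_on_weight continuous_on_compose2[OF f]) auto
  have "(LBINT v. chi \<kappa> \<gamma> \<rho> (v - u) * f v) =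
      \<bar>s\<bar> *\<^sub>R (LBINT z. chi \<kappa> \<gamma> \<rho> ((u + s * z) - u) * f (u + s * z))"
    by (rule lborel_integral_real_affine) (use s in simp)
  also have "\<dots> = (LBINT z. s * chi \<kappa> \<gamma> \<rho> (s * z) * f (u + s * z))"
    using s by (simp add: mult.assoc)
  also have "\<dots> = (LBINT z. scale * \<rho> * (indicator {-1..1} z * (weight z * f (u + s * z))))"
    by (simp add: chi mult.assoc)
  also have "\<dots> = scale * \<rho> * (LBINT z:{-1..1}. weight z * f (u + s * z))"
    by (simp add: set_lebesgue_integral_def)
  also have "(LBINT z:{-1..1}. weight z * f (u + s * z)) =
      integral {-1..1} (\<lambda>z. weight z * f (u + s * z))"
    by (rule set_borel_integral_eq_integral) (rule borel_integrable_atLeastAtMost'[OF cont])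
  finally show ?thesis by (simp add: s_def)
qed

text \<open>One integral covers both cases: \<open>f\<close> sees the state velocity and the kinetic
  velocity. Cutting the density off at 0 gives a continuous function on the whole plane that agrees
  with entropy or flux on nonnegative densities.\<close>

definition moment :: "(real \<times> real \<Rightarrow> real) \<Rightarrow> real \<times> real \<Rightarrow> real" where
  "moment f U = scale * max 0 (fst U) *
     integral {-1..1} (\<lambda>z. weight z * f (snd U, snd U + a * max 0 (fst U) powr \<theta> * z))"

lemma continuous_on_moment:
  assumes f: "continuous_on UNIV f"
  shows "continuous_on UNIV (moment f)"
proof -
  have w: "continuous_on (UNIV \<times> {-1..1}) (\<lambda>x :: (real \<times> real) \<times> real. weight (snd x))"
    by (rule continuous_on_compose2[OF continuous_on_weight]) (auto intro!: continuous_intros)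
  have "continuous_on UNIV (\<lambda>U. integral (cbox (-1) 1)
      (\<lambda>z. weight z * f (snd U, snd U + a * max 0 (fst U) powr \<theta> * z)))"
    by (rule integral_continuous_on_param)
      (use theta_pos in \<open>auto simp: split_beta
        intro!: w continuous_intros continuous_on_powr' continuous_on_compose2[OF f]\<close>)
  then show ?thesis unfolding moment_def by (auto intro!: continuous_intros)
qed

lemma entropy_eq_moment:
  assumes "continuous_on UNIV S" and "fst U \<ge> 0"
  shows "entropy \<kappa> \<gamma> S U = moment (\<lambda>(u, v). S v) U"
  using assms chi_integral[of S "fst U" "snd U"]
  by (simp add: entropy_def moment_def split_beta max_def)

lemma entropy_flux_eq_moment:
  assumes S: "continuous_on UNIV S" and "fst U \<ge> 0"
  shows "entropy_flux \<kappa> \<gamma> S U = moment (\<lambda>(u, v). ((1 - \<theta>) * u + \<theta> * v) * S v) U"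
proof -
  have "continuous_on UNIV (\<lambda>v. ((1 - \<theta>) * snd U + \<theta> * v) * S v)"
    by (intro continuous_intros S)
  from chi_integral[OF this, of "fst U" "snd U"] assms(2) show ?thesis
    by (simp add: entropy_flux_def moment_def split_beta max_def mult_ac)
qed

lemma entropy_flux_at_rest:
  assumes S: "continuous_on UNIV S" "\<And>v. S v = S (- v)" and "\<rho> \<ge> 0"
  shows "entropy_flux \<kappa> \<gamma> S (\<rho>, 0) = 0"
proof -
  have "integral {-1..1} (\<lambda>z. weight z * (\<theta> * (a * \<rho> powr \<theta> * z) * S (a * \<rho> powr \<theta> * z))) = 0"
    by (rule integral_odd_eq_0) (use S(2) in \<open>simp add: weight_even\<close>)
  then show ?thesis using entropy_flux_eq_moment[OF S(1), of "(\<rho>, 0)"] assms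
    by (simp add: moment_def max_def)
qed

lemma entropy_tangent_at_rest:
  assumes S: "convex_on UNIV S" "\<And>v. S v = S (- v)" and "\<rho>s \<ge> 0"
  obtains c where "\<And>U. fst U \<ge> 0 \<Longrightarrow>
    entropy \<kappa> \<gamma> S U \<ge> entropy \<kappa> \<gamma> S (\<rho>s, 0) + c * (fst U - \<rho>s)"
proof -
  have cS: "continuous_on UNIV S"
    by (rule convex_on_continuous) (use S in auto)
  have cI: "(\<lambda>z. weight z * S (u + b * z)) integrable_on {-1..1}" for u b
    by (intro integrable_continuous_interval continuous_intros continuous_on_weight
        continuous_on_compose2[OF cS]) auto
  define h where "h \<rho> = scale * \<rho> * integral {-1..1} (\<lambda>z. weight z * S (a * \<rho> powr \<theta> * z))" for \<rho>
  have ent: "entropy \<kappa> \<gamma> S (\<rho>, u) =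
      scale * \<rho> * integral {-1..1} (\<lambda>z. weight z * S (u + a * \<rho> powr \<theta> * z))" if "\<rho> \<ge> 0" for \<rho> u
    using that entropy_eq_moment[OF cS, of "(\<rho>, u)"] by (simp add: moment_def max_def)
  have rest: "entropy \<kappa> \<gamma> S (\<rho>, u) \<ge> h \<rho>" if "\<rho> \<ge> 0" for \<rho> u
  proof -
    define b where "b = a * \<rho> powr \<theta>"
    have "2 * integral {-1..1} (\<lambda>z. weight z * S (b * z)) =
        integral {-1..1} (\<lambda>z. 2 * (weight z * S (b * z)))" by simp
    \<comment> \<open>Symmetrise in z: the summand with -b is the reflection of the one with b and
      has the same integral, because the weight is even.\<close>
    also have "\<dots> \<le> integral {-1..1} (\<lambda>z. weight z * S (u + b * z) + weight z * S (u + (- b) * z))"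
    proof (intro integral_le integrable_add cI)
      show "(\<lambda>z. 2 * (weight z * S (b * z))) integrable_on {-1..1}"
        using integrable_on_cmult_left[OF cI[of 0 b], of 2] by simp
      fix z :: real
      have "weight z * (2 * S (b * z)) \<le> weight z * (S (u + b * z) + S (u - b * z))"
        by (intro mult_left_mono even_convex_le_mean S weight_nonneg)
      then show "2 * (weight z * S (b * z)) \<le> weight z * S (u + b * z) + weight z * S (u + (- b) * z)"
        by (simp add: algebra_simps)
    qed
    also have "\<dots> = integral {-1..1} (\<lambda>z. weight z * S (u + b * z)) +
        integral {-1..1} (\<lambda>z. weight z * S (u + (- b) * z))"
      by (intro Henstock_Kurzweil_Integration.integral_add cI)
    also have "integral {-1..1} (\<lambda>z. weight z * S (u + (- b) * z)) =
        integral {-1..1} (\<lambda>z. weight z * S (u + b * z))"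
      using Henstock_Kurzweil_Integration.integral_reflect_real[of 1 "-1" "\<lambda>z. weight z * S (u + b * z)"]
      by (simp add: weight_even)
    finally have "integral {-1..1} (\<lambda>z. weight z * S (b * z)) \<le>
        integral {-1..1} (\<lambda>z. weight z * S (u + b * z))" by simp
    then show ?thesis unfolding ent[OF that] h_def b_def
      using that scale_nonneg by (intro mult_left_mono) auto
  qed
  have h_rest: "entropy \<kappa> \<gamma> S (\<rho>s, 0) = h \<rho>s"
    using ent[OF \<open>\<rho>s \<ge> 0\<close>, of 0] by (simp add: h_def)
  obtain c where c: "\<And>\<rho>. \<rho> \<ge> 0 \<Longrightarrow> h \<rho> \<ge> h \<rho>s + c * (\<rho> - \<rho>s)"
  proof (cases "\<rho>s = 0")
    case True
    define c where "c = scale * integral {-1..1} (\<lambda>z. weight z * S 0)"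
    have "h \<rho> \<ge> h \<rho>s + c * (\<rho> - \<rho>s)" if "\<rho> \<ge> 0" for \<rho>
    proof -
      have "integral {-1..1} (\<lambda>z. weight z * S 0) \<le>
          integral {-1..1} (\<lambda>z. weight z * S (a * \<rho> powr \<theta> * z))"
      proof (intro integral_le)
        show "(\<lambda>z. weight z * S 0) integrable_on {-1..1}" using cI[of 0 0] by simp
        show "(\<lambda>z. weight z * S (a * \<rho> powr \<theta> * z)) integrable_on {-1..1}"
          using cI[of 0 "a * \<rho> powr \<theta>"] by simp
        fix z :: real
        show "weight z * S 0 \<le> weight z * S (a * \<rho> powr \<theta> * z)"
          using even_convex_le_mean[OF S, of 0 "a * \<rho> powr \<theta> * z"] S(2)[of "a * \<rho> powr \<theta> * z"]
          by (intro mult_left_mono weight_nonneg) simp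
      qed
      then have "scale * \<rho> * integral {-1..1} (\<lambda>z. weight z * S 0) \<le> h \<rho>"
        unfolding h_def using that scale_nonneg by (intro mult_left_mono) auto
      with True show ?thesis by (simp add: c_def h_def mult_ac)
    qed
    with that show ?thesis by blast
  next
    case False
    have "convex_on {0..} h"
    proof (rule convex_onI)
      fix t x y :: real assume t: "t > 0" "t < 1" and xy: "x \<in> {0..}" "y \<in> {0..}"
      \<comment> \<open>The density is moved under the integral, so that convexity can be used for
        each fixed z with b = a z.\<close>
      define k where "k r z = weight z * (r * S (a * z * r powr \<theta>))" for r z
      have ki: "k r integrable_on {-1..1}" for r
        using integrable_on_cmult_left[OF cI[of 0 "a * r powr \<theta>"], of r]
        unfolding k_def[abs_def] by (simp add: mult_ac)
      have cki: "(\<lambda>z. c * k r z) integrable_on {-1..1}" for c r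
        using integrable_on_cmult_left[OF ki, of c r] by simp
      have hk: "h r = scale * integral {-1..1} (k r)" for r
      proof -
        have "integral {-1..1} (k r) = integral {-1..1} (\<lambda>z. r * (weight z * S (a * r powr \<theta> * z)))"
          by (intro integral_cong) (simp add: k_def mult_ac)
        then show ?thesis by (simp add: h_def)
      qed
      have "integral {-1..1} (k ((1 - t) *\<^sub>R x + t *\<^sub>R y)) \<le>
          integral {-1..1} (\<lambda>z. (1 - t) * k x z + t * k y z)"
      proof (intro integral_le integrable_add cki ki)
        fix z :: real
        have "((1 - t) *\<^sub>R x + t *\<^sub>R y) * S (a * z * ((1 - t) *\<^sub>R x + t *\<^sub>R y) powr \<theta>) \<le>
            (1 - t) * (x * S (a * z * x powr \<theta>)) + t * (y * S (a * z * y powr \<theta>))"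
          by (rule convex_onD[OF convex_on_density_times_even[OF S theta_pos]]) (use t xy in auto)
        from mult_left_mono[OF this weight_nonneg[of z]]
        show "k ((1 - t) *\<^sub>R x + t *\<^sub>R y) z \<le> (1 - t) * k x z + t * k y z"
          by (simp add: k_def algebra_simps)
      qed
      also have "\<dots> = (1 - t) * integral {-1..1} (k x) + t * integral {-1..1} (k y)"
        by (subst Henstock_Kurzweil_Integration.integral_add)
          (auto intro!: cki)
      finally have "scale * integral {-1..1} (k ((1 - t) *\<^sub>R x + t *\<^sub>R y)) \<le>
          scale * ((1 - t) * integral {-1..1} (k x) + t * integral {-1..1} (k y))"
        by (intro mult_left_mono scale_nonneg)
      then show "h ((1 - t) *\<^sub>R x + t *\<^sub>R y) \<le> (1 - t) * h x + t * h y"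
        by (simp add: hk algebra_simps)
    qed simp
    from convex_le_Inf_differential[OF this, of \<rho>s] False \<open>\<rho>s \<ge> 0\<close> that show ?thesis
      by (force simp: interior_real_atLeast)
  qed
  have "entropy \<kappa> \<gamma> S U \<ge> entropy \<kappa> \<gamma> S (\<rho>s, 0) + c * (fst U - \<rho>s)" if "fst U \<ge> 0" for U
    using rest[OF that, of "snd U"] c[OF that] by (simp add: h_rest)
  with that show ?thesis by blast
qed

end

subsection \<open>Self-similar functions and test functions\<close>

text \<open>Measurability of \<open>X\<close> is not assumed: completeness of Lebesgue measure
  transfers it from the Borel function \<open>Y\<close>, which agrees almost everywhere.\<close>

lemma integral_lebesgue_on_eq_lborel:
  fixes X Y :: "'a::euclidean_space \<Rightarrow> real"
  assumes \<Omega>: "\<Omega> \<in> sets lebesgue" and Y: "Y \<in> borel_measurable borel"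
    and eq: "AE p in lborel. p \<in> \<Omega> \<longrightarrow> X p = Y p" and Y0: "\<And>p. p \<notin> \<Omega> \<Longrightarrow> Y p = 0"
  shows "(LINT p|lebesgue_on \<Omega>. X p) = (LINT p|lborel. Y p)"
proof -
  have Yl: "Y \<in> borel_measurable lebesgue"
    by (rule measurable_completion) (use Y in simp)
  have ae: "AE p in lebesgue. indicator \<Omega> p *\<^sub>R X p = Y p"
    using AE_completion[OF eq] by eventually_elim (auto simp: indicator_def Y0)
  have Xl: "(\<lambda>p. indicator \<Omega> p *\<^sub>R X p) \<in> borel_measurable lebesgue"
  proof (rule measurableI)
    fix A :: "real set" assume "A \<in> sets borel"
    with Yl have "Y -` A \<inter> space lebesgue \<in> sets lebesgue" by (rule measurable_sets)
    then show "(\<lambda>p. indicator \<Omega> p *\<^sub>R X p) -` A \<inter> space lebesgue \<in> sets lebesgue"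
      by (rule completion.in_sets_AE[rotated]) (use ae in \<open>auto elim!: eventually_mono\<close>)
  qed simp
  have "(LINT p|lebesgue_on \<Omega>. X p) = (LINT p|lebesgue. indicator \<Omega> p *\<^sub>R X p)"
    by (rule integral_restrict_space) (use \<Omega> in simp)
  also have "\<dots> = (LINT p|lebesgue. Y p)"
    by (rule integral_cong_AE[OF Xl Yl ae])
  also have "\<dots> = (LINT p|lborel. Y p)"
    by (rule integral_completion) (use Y in simp)
  finally show ?thesis .
qed

section \<open>Null sets under the scaling (t, x) to x/t, and integrability of products\<close>

lemma AE_lborel_scale:
  fixes c :: real
  assumes "AE x in lborel. P x" and "c \<noteq> 0"
  shows "AE x in lborel. P (c * x)"
proof -
  obtain N where N: "N \<in> null_sets lborel" "{x. \<not> P x} \<subseteq> N"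
    using assms(1) by (auto simp: eventually_ae_filter)
  then have [measurable]: "N \<in> sets borel" by auto
  have "AE x in lborel. x \<notin> N" by (rule AE_not_in[OF N(1)])
  then have "AE x in lborel. 0 + c * x \<notin> N"
    by (intro AE_borel_affine[where P = "\<lambda>x. x \<notin> N"] assms(2)) measurable
  then show ?thesis by eventually_elim (use N in auto)
qed

text \<open>By Fubini almost every time slice is good. As (0, 1) is not a null set, some positive
  time is good, and rescaling that slice turns x into t times \<xi>. This reads a self-similar
  profile off the plane.\<close>

lemma AE_half_plane_imp_ray:
  fixes P :: "real \<times> real \<Rightarrow> bool"
  assumes "AE p in lborel. 0 < fst p \<longrightarrow> P p"
  obtains t where "t > 0" and "AE \<xi> in lborel. P (t, t * \<xi>)"
proof -
  have "AE p in (lborel :: real measure) \<Otimes>\<^sub>M (lborel :: real measure). 0 < fst p \<longrightarrow> P p"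
    using assms unfolding lborel_prod .
  from lborel_pair.AE_pair[OF this]
  have ae: "AE t in lborel. AE x in lborel. 0 < t \<longrightarrow> P (t, x)" by simp
  have "\<exists>t>0. AE x in lborel. P (t, x)"
  proof (rule ccontr)
    assume contr: "\<not> ?thesis"
    from ae have "AE t in lborel. t \<notin> {0<..<1::real}"
      by eventually_elim (use contr in auto)
    then have "{0<..<1::real} \<in> null_sets lborel"
      by (simp add: AE_iff_null_sets)
    then show False by (auto simp: null_sets_def)
  qed
  then obtain t where "t > 0" "AE x in lborel. P (t, x)" by blast
  with that AE_lborel_scale[of "\<lambda>x. P (t, x)" t] show ?thesis by auto
qed

text \<open>The converse passage: each slice of the cone over a null set is a rescaled null set, so
  Fubini makes the cone null.\<close>

lemma AE_ray_imp_half_plane: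
  fixes P :: "real \<Rightarrow> bool"
  assumes "AE \<xi> in lborel. P \<xi>"
  shows "AE p in lborel. 0 < fst p \<longrightarrow> P (snd p / fst p)"
proof -
  obtain N where N: "N \<in> null_sets lborel" "{x. \<not> P x} \<subseteq> N"
    using assms by (auto simp: eventually_ae_filter)
  then have [measurable]: "N \<in> sets borel" by auto
  have *: "AE x in lborel. x / t \<notin> N" if "0 < t" for t :: real
  proof -
    have "AE x in lborel. inverse t * x \<notin> N"
      using AE_not_in[OF N(1)] that by (intro AE_lborel_scale) auto
    then show ?thesis by eventually_elim (simp add: field_simps)
  qed
  have "AE p in (lborel :: real measure) \<Otimes>\<^sub>M (lborel :: real measure).
      0 < fst p \<longrightarrow> snd p / fst p \<notin> N"
    by (rule lborel_pair.AE_pair_measure) (measurable, auto intro: *)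
  then have "AE p in lborel. 0 < fst p \<longrightarrow> snd p / fst p \<notin> N"
    unfolding lborel_prod .
  then show ?thesis by eventually_elim (use N in auto)
qed

lemma product_integrable:
  fixes f g :: "real \<Rightarrow> real"
  assumes f: "integrable lborel f" and g: "integrable lborel g"
  shows "integrable lborel (\<lambda>p. f (fst p) * g (snd p))"
proof -
  note [measurable] = borel_measurable_integrable[OF f] borel_measurable_integrable[OF g]
  have "integrable (lborel \<Otimes>\<^sub>M lborel) (\<lambda>p. f (fst p) * g (snd p))"
  proof (rule lborel_pair.Fubini_integrable)
    show "integrable lborel (\<lambda>x. LINT y|lborel. norm (f (fst (x, y)) * g (snd (x, y))))"
      using f by (simp add: abs_mult)
    show "AE x in lborel. integrable lborel (\<lambda>y. f (fst (x, y)) * g (snd (x, y)))"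
      using g by simp
  qed measurable
  then show ?thesis by (simp add: lborel_prod)
qed

lemma integrable_bounded_times:
  fixes f g :: "'a \<Rightarrow> real"
  assumes "integrable M g" and "f \<in> borel_measurable M" and "\<And>x. \<bar>f x\<bar> \<le> C"
  shows "integrable M (\<lambda>x. f x * g x)"
proof (rule Bochner_Integration.integrable_bound)
  show "integrable M (\<lambda>x. C * g x)" using assms(1) by simp
  have "0 \<le> C" using assms(3) by (meson abs_ge_zero order_trans)
  then show "AE x in M. norm (f x * g x) \<le> norm (C * g x)"
    using assms(3) by (auto simp: abs_mult intro!: mult_right_mono)
qed (use assms in measurable)

lemma integral_derivative_compact_support:
  fixes F f :: "real \<Rightarrow> real"
  assumes d: "\<And>x. (F has_real_derivative f x) (at x)" and c: "\<And>x. isCont f x"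
    and s: "\<And>x. x \<notin> {u..v} \<Longrightarrow> f x = 0" and "u \<le> v"
  shows "integrable lborel f" and "(LINT x|lborel. f x) = F v - F u"
proof -
  have eq: "(\<lambda>x. f x * indicator {u..v} x) = f"
    using s by (auto simp: indicator_def fun_eq_iff)
  have "has_bochner_integral lborel (\<lambda>x. f x * indicator {u..v} x) (F v - F u)"
    by (rule has_bochner_integral_FTC_Icc_real) (use assms in auto)
  then show "integrable lborel f" "(LINT x|lborel. f x) = F v - F u"
    unfolding eq by (auto simp: has_bochner_integral_iff)
qed

text \<open>The one-variable counterpart of the family of derivatives in
  \<open>test_function\<close>; products of two such families are the only test functions
  used.\<close>

definition derivative_family :: "(nat \<Rightarrow> real \<Rightarrow> real) \<Rightarrow> bool" where
  "derivative_family f \<longleftrightarrow> (\<forall>n x. (f n has_real_derivative f (Suc n) x) (at x))"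

lemma derivative_familyD:
  "derivative_family f \<Longrightarrow> (f n has_real_derivative f (Suc n) x) (at x)"
  by (simp add: derivative_family_def)

lemma derivative_family_isCont: "derivative_family f \<Longrightarrow> isCont (f n) x"
  using derivative_familyD DERIV_isCont by blast

lemma derivative_family_vanish:
  assumes f: "derivative_family f" and "\<And>x. x \<notin> {u..v} \<Longrightarrow> f 0 x = 0" and "x \<notin> {u..v}"
  shows "f n x = 0"
  using assms(3)
proof (induction n arbitrary: x)
  case (Suc n)
  have op: "open (- {u..v})" by (simp add: open_Compl)
  have "((\<lambda>_. 0) has_real_derivative 0) (at x)" by simp
  then have "(f n has_real_derivative 0) (at x)"
    by (rule has_field_derivative_transform_within_open[OF _ op]) (use Suc in auto)
  then show ?case using derivative_familyD[OF f] DERIV_unique by blast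
qed (use assms in auto)

lemma derivative_family_integrable:
  assumes f: "derivative_family f" and v: "\<And>x. x \<notin> {u..v} \<Longrightarrow> f 0 x = 0"
  shows "integrable lborel (f n)"
proof -
  have "continuous_on {u..v} (f n)"
    by (intro continuous_at_imp_continuous_on ballI derivative_family_isCont f)
  then have "integrable lborel (\<lambda>x. indicator {u..v} x *\<^sub>R f n x)"
    by (intro borel_integrable_compact) auto
  moreover have "(\<lambda>x. indicator {u..v} x *\<^sub>R f n x) = f n"
    using derivative_family_vanish[OF f, of u v _ n] v by (auto simp: indicator_def fun_eq_iff)
  ultimately show ?thesis by simp
qed

lemma integral_derivative_family_Suc:
  assumes f: "derivative_family f" and v: "\<And>x. x \<notin> {u..v} \<Longrightarrow> f 0 x = 0"
  shows "(LINT x|lborel. f (Suc n) x) = 0"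
proof -
  \<comment> \<open>The maximum keeps the integration interval from u - 1 to b nonempty even when u
    > v.\<close>
  define b where "b = max u v + 1"
  have z: "f m x = 0" if "x < u \<or> v < x" for m x
    using derivative_family_vanish[OF f, of u v x m] v that by auto
  have zb: "f m x = 0" if "b \<le> x" for m x
    by (rule z) (use that in \<open>simp add: b_def, linarith\<close>)
  have "(LINT x|lborel. f (Suc n) x) = f n b - f n (u - 1)"
    by (rule integral_derivative_compact_support(2)[where F = "f n"])
      (use z zb in \<open>auto simp: b_def intro: derivative_familyD[OF f] derivative_family_isCont[OF f]\<close>)
  also have "\<dots> = 0" using zb[of b n] z[of "u - 1" n] by simp
  finally show ?thesis .
qed

text \<open>Test with \<alpha>(t) \<beta>(x), where \<alpha> has mass 1 and \<beta> approximates the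
  indicator of x < 0 over the region where \<open>e\<close> lives. Self-similarity turns the space
  integral of \<open>e\<close> into t M, and the time integral of t \<alpha>' is -1, so the density
  term tends to -M. The falling edge of \<beta> contributes at most about -L, hence L + M is at most
  0.\<close>

lemma self_similar_flux_nonpos:
  fixes e q :: "real \<Rightarrow> real"
  assumes e[measurable]: "e \<in> borel_measurable borel" and q[measurable]: "q \<in> borel_measurable borel"
    and eC: "\<And>\<xi>. \<bar>e \<xi>\<bar> \<le> C" and qC: "\<And>\<xi>. \<bar>q \<xi>\<bar> \<le> C"
    and e0: "\<And>\<xi>. 0 \<le> e \<xi>" and es: "\<And>\<xi>. \<xi> < s \<Longrightarrow> e \<xi> = 0" and qs: "\<And>\<xi>. \<xi> < s \<Longrightarrow> q \<xi> = 0"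
    and weak: "\<And>\<alpha> \<beta> u v u' v'. \<lbrakk>derivative_family \<alpha>; derivative_family \<beta>; \<And>t. 0 \<le> \<alpha> 0 t; \<And>x. 0 \<le> \<beta> 0 x;
      0 < u; \<And>t. t \<notin> {u..v} \<Longrightarrow> \<alpha> 0 t = 0; \<And>x. x \<notin> {u'..v'} \<Longrightarrow> \<beta> 0 x = 0\<rbrakk> \<Longrightarrow>
      0 \<le> (LINT p|lborel. e (snd p / fst p) * (\<alpha> 1 (fst p) * \<beta> 0 (snd p)) +
        q (snd p / fst p) * (\<alpha> 0 (fst p) * \<beta> 1 (snd p)))"
    and lim: "\<And>\<eta>. \<eta> > 0 \<Longrightarrow> \<exists>\<delta>>0. AE \<xi> in lborel. 0 < \<xi> \<and> \<xi> < \<delta> \<longrightarrow> L - \<eta> \<le> q \<xi>"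
  shows "L \<le> 0"
proof -
  obtain B :: "nat \<Rightarrow> real \<Rightarrow> real" where B: "\<And>n x. (B n has_real_derivative B (Suc n) x) (at x)"
    and B_left: "\<And>x. x \<le> 0 \<Longrightarrow> B 0 x = 0" and B_right: "\<And>x. x \<ge> 1 \<Longrightarrow> B 0 x = 1"
    and B_nonneg: "\<And>x. 0 \<le> B 0 x" and B_le_1: "\<And>x. B 0 x \<le> 1" and B1: "\<And>x. 0 \<le> B 1 x"
    and Bz: "\<And>n x. x \<notin> {0..1} \<Longrightarrow> B (Suc n) x = 0"
    using smooth_step_exists by metis
  have C: "0 \<le> C" using eC[of 0] by linarith
  \<comment> \<open>The index is shifted by one: \<open>\<alpha> 0\<close> is the derivative of the
    step, hence a nonnegative bump of mass 1 on times 1 to 2.\<close>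
  define \<alpha> where "\<alpha> n t = B (Suc n) (t - 1)" for n t
  have \<alpha>: "derivative_family \<alpha>"
    unfolding derivative_family_def \<alpha>_def
    by (intro allI DERIV_cong[OF DERIV_chain'[OF _ B]]) (auto intro!: derivative_eq_intros)
  have \<alpha>0: "0 \<le> \<alpha> 0 t" for t using B1 by (simp add: \<alpha>_def)
  have \<alpha>z: "\<alpha> n t = 0" if "t \<notin> {1..2}" for n t using Bz that by (simp add: \<alpha>_def)
  have \<alpha>_int: "integrable lborel (\<alpha> n)" for n
    by (rule derivative_family_integrable[OF \<alpha>, of 1 2]) (use \<alpha>z in auto)
  have \<alpha>_1: "(LINT t|lborel. \<alpha> 0 t) = 1"
  proof -
    have "(LINT t|lborel. \<alpha> 0 t) = B 0 (3 - 1) - B 0 (0 - 1)"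
    proof (rule integral_derivative_compact_support(2)[where F = "\<lambda>t. B 0 (t - 1)"])
      show "((\<lambda>t. B 0 (t - 1)) has_real_derivative \<alpha> 0 t) (at t)" for t
        by (rule DERIV_cong[OF DERIV_chain'[OF _ B]])
          (auto intro!: derivative_eq_intros simp: \<alpha>_def)
      show "isCont (\<alpha> 0) t" for t by (rule derivative_family_isCont[OF \<alpha>])
    qed (use \<alpha>z in auto)
    then show ?thesis by (simp add: B_left B_right)
  qed
  \<comment> \<open>The integrand is the derivative of t \<alpha>(t), so its integral vanishes and t
    \<alpha>' integrates to minus the mass of \<alpha>.\<close>
  have t\<alpha>: "integrable lborel (\<lambda>t. \<alpha> 0 t + t * \<alpha> 1 t)"
    "(LINT t|lborel. \<alpha> 0 t + t * \<alpha> 1 t) = 3 * \<alpha> 0 3 - 0 * \<alpha> 0 0"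
    by (rule integral_derivative_compact_support[where F = "\<lambda>t. t * \<alpha> 0 t" and u = 0 and v = 3];
      use \<alpha>z derivative_familyD[OF \<alpha>, of 0] derivative_family_isCont[OF \<alpha>] in
        \<open>auto intro!: derivative_eq_intros continuous_intros\<close>)+
  have t\<alpha>_int: "integrable lborel (\<lambda>t. t * \<alpha> 1 t)"
    using Bochner_Integration.integrable_diff[OF t\<alpha>(1) \<alpha>_int[of 0]] by simp
  have t\<alpha>_1: "(LINT t|lborel. t * \<alpha> 1 t) = - 1"
    using t\<alpha>(2) Bochner_Integration.integral_add[OF \<alpha>_int[of 0] t\<alpha>_int] \<alpha>z[of 3] \<alpha>_1 by simp

  \<comment> \<open>For times between 1 and 2, every x at most -R has x/t < s. The rising edge of
    the cutoff is placed there, where \<open>e\<close> and \<open>q\<close> vanish.\<close>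
  define R where "R = 2 * \<bar>s\<bar> + 2"
  have left: "x / t < s" if "x \<le> - R" "t \<in> {1..2}" for x t
  proof -
    have "t * \<bar>s\<bar> \<le> 2 * \<bar>s\<bar>" using that by (intro mult_right_mono) auto
    moreover have "t * (- \<bar>s\<bar>) \<le> t * s" using that by (intro mult_left_mono) auto
    ultimately have "x < t * s" using that by (simp add: R_def)
    then show ?thesis using that by (simp add: divide_less_eq mult.commute)
  qed
  define M where "M = (LINT \<xi>|lborel. e \<xi> * indicator {..0} \<xi>)"
  have M0: "0 \<le> M" unfolding M_def by (intro integral_nonneg_AE) (auto simp: e0)
  have M_scale: "(LINT x|lborel. e (x / t) * indicator {..0} x) = t * M"
    "integrable lborel (\<lambda>x. e (x / t) * indicator {..0} x)" if "t \<in> {1..2}" for t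
  proof -
    have "(LINT x|lborel. e (x / t) * indicator {..0} x) =
        \<bar>t\<bar> *\<^sub>R (LINT \<xi>|lborel. e ((0 + t * \<xi>) / t) * indicator {..0} (0 + t * \<xi>))"
      by (rule lborel_integral_real_affine) (use that in auto)
    also have "(\<lambda>\<xi>. e ((0 + t * \<xi>) / t) * indicator {..0} (0 + t * \<xi>)) = (\<lambda>\<xi>. e \<xi> * indicator {..0} \<xi>)"
      using that by (auto simp: fun_eq_iff indicator_def mult_le_0_iff)
    finally show "(LINT x|lborel. e (x / t) * indicator {..0} x) = t * M"
      using that by (simp add: M_def)
    have "integrable lborel (\<lambda>x. e (x / t) * indicator {- R..0} x)"
      by (rule integrable_bounded_times[where C = C, OF integrable_real_indicator])
        (use eC in \<open>auto simp: emeasure_lborel_Icc_eq\<close>)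
    also have "(\<lambda>x. e (x / t) * indicator {- R..0} x) = (\<lambda>x. e (x / t) * indicator {..0} x)"
      using left[OF _ that] es by (auto simp: fun_eq_iff indicator_def)
    finally show "integrable lborel (\<lambda>x. e (x / t) * indicator {..0} x)" .
  qed
  define A where "A = (LINT t|lborel. \<bar>\<alpha> 1 t\<bar>)"

  have key: "L \<le> \<eta> + C * \<epsilon> * A"
    if \<eta>: "\<eta> > 0" and \<epsilon>: "\<epsilon> > 0" and qL: "AE \<xi> in lborel. 0 < \<xi> \<and> \<xi> \<le> \<epsilon> \<longrightarrow> L - \<eta> \<le> q \<xi>" for \<eta> \<epsilon>
  proof -
    \<comment> \<open>a plateau that rises where the state is still constant and falls on \<open>(0, \<epsilon>)\<close>, so that
      \<open>\<beta> 1\<close> sees \<open>q\<close> only near \<open>0+\<close>\<close>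
    define \<beta> where "\<beta> n x = B n (x + R + 1) - B n (x / \<epsilon>) / \<epsilon> ^ n" for n x
    have \<beta>: "derivative_family \<beta>"
      unfolding derivative_family_def
    proof (intro allI)
      fix n x
      have "((\<lambda>x. B n (x + R + 1)) has_real_derivative B (Suc n) (x + R + 1)) (at x)"
        by (rule DERIV_cong[OF DERIV_chain'[OF _ B]]) (auto intro!: derivative_eq_intros)
      moreover have "((\<lambda>x. B n (x / \<epsilon>)) has_real_derivative B (Suc n) (x / \<epsilon>) * (1 / \<epsilon>)) (at x)"
        by (rule DERIV_cong[OF DERIV_chain'[OF _ B]]) (use \<epsilon> in \<open>auto intro!: derivative_eq_intros\<close>)
      then have "((\<lambda>x. B n (x / \<epsilon>) / \<epsilon> ^ n) has_real_derivative B (Suc n) (x / \<epsilon>) * (1 / \<epsilon>) / \<epsilon> ^ n) (at x)"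
        by (rule DERIV_cdivide)
      ultimately have "(\<beta> n has_real_derivative
          B (Suc n) (x + R + 1) - B (Suc n) (x / \<epsilon>) * (1 / \<epsilon>) / \<epsilon> ^ n) (at x)"
        unfolding \<beta>_def by (rule DERIV_diff)
      then show "(\<beta> n has_real_derivative \<beta> (Suc n) x) (at x)"
        by (simp add: \<beta>_def)
    qed
    have \<beta>_nonneg: "0 \<le> \<beta> 0 x" for x
    proof (cases "x \<le> 0")
      case True
      with \<epsilon> have "x / \<epsilon> \<le> 0" by (simp add: divide_nonpos_pos)
      with B_nonneg show ?thesis by (simp add: \<beta>_def B_left)
    next
      case False
      with B_le_1 show ?thesis by (simp add: \<beta>_def B_right R_def)
    qed
    have \<beta>z: "\<beta> 0 x = 0" if "x \<notin> {- R - 1..\<epsilon>}" for x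
    proof (cases "x < - R - 1")
      case True
      then have "x \<le> 0" by (simp add: R_def)
      with \<epsilon> have "x / \<epsilon> \<le> 0" by (simp add: divide_nonpos_pos)
      with True show ?thesis by (simp add: \<beta>_def B_left)
    next
      case False
      with that \<epsilon> have "x > \<epsilon>" by auto
      with \<epsilon> have "x / \<epsilon> \<ge> 1" "x + R + 1 \<ge> 1" by (auto simp: R_def)
      then show ?thesis by (simp add: \<beta>_def B_right)
    qed
    have \<beta>_int: "integrable lborel (\<beta> n)" for n
      by (rule derivative_family_integrable[OF \<beta>, of "- R - 1" \<epsilon>]) (use \<beta>z in auto)
    have \<alpha>_meas[measurable]: "\<alpha> n \<in> borel_measurable borel" and \<beta>_meas[measurable]: "\<beta> n \<in> borel_measurable borel" for n
      using borel_measurable_integrable[OF \<alpha>_int] borel_measurable_integrable[OF \<beta>_int] by auto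

    define F where "F p = e (snd p / fst p) * (\<alpha> 1 (fst p) * \<beta> 0 (snd p)) +
      q (snd p / fst p) * (\<alpha> 0 (fst p) * \<beta> 1 (snd p))" for p
    have F_int: "integrable lborel F"
      unfolding F_def
      by (intro Bochner_Integration.integrable_add integrable_bounded_times[where C = C]
          product_integrable \<alpha>_int \<beta>_int) (use eC qC in \<open>auto simp: borel_prod[symmetric]\<close>)
    then have F_int': "integrable (lborel \<Otimes>\<^sub>M lborel) F" by (simp add: lborel_prod)
    have "0 \<le> (LINT p|lborel. F p)"
      unfolding F_def by (rule weak[where u = 1 and v = 2 and u' = "- R - 1" and v' = \<epsilon>, OF \<alpha> \<beta> \<alpha>0 \<beta>_nonneg _ \<alpha>z \<beta>z]) auto
    also have "\<dots> = (LINT t|lborel. LINT x|lborel. F (t, x))"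
      using lborel_pair.integral_fst'[OF F_int'] by (simp add: lborel_prod)
    \<comment> \<open>The estimate is made slice by slice. Integrated over t, the three terms give
      -M, the cutoff error, and -(L - \<eta>).\<close>
    also have "\<dots> \<le> (LINT t|lborel. t * \<alpha> 1 t * M + C * \<epsilon> * \<bar>\<alpha> 1 t\<bar> + \<alpha> 0 t * (- (L - \<eta>)))"
    proof (rule integral_mono)
      show "integrable lborel (\<lambda>t. LINT x|lborel. F (t, x))"
        by (rule lborel_pair.integrable_fst'[OF F_int'])
      show "integrable lborel (\<lambda>t. t * \<alpha> 1 t * M + C * \<epsilon> * \<bar>\<alpha> 1 t\<bar> + \<alpha> 0 t * (- (L - \<eta>)))"
        by (intro Bochner_Integration.integrable_add integrable_mult_left integrable_mult_right
            integrable_abs \<alpha>_int t\<alpha>_int)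
      fix t :: real
      show "(LINT x|lborel. F (t, x)) \<le> t * \<alpha> 1 t * M + C * \<epsilon> * \<bar>\<alpha> 1 t\<bar> + \<alpha> 0 t * (- (L - \<eta>))"
      proof (cases "t \<in> {1..2}")
        case False
        with \<alpha>z[OF False] show ?thesis by (simp add: F_def)
      next
        case t: True
        have I_int: "integrable lborel (\<lambda>x. e (x / t) * \<beta> 0 x)"
          and J_int: "integrable lborel (\<lambda>x. q (x / t) * \<beta> 1 x)"
          by (rule integrable_bounded_times[where C = C]; use eC qC \<beta>_int in simp)+
        define I where "I = (LINT x|lborel. e (x / t) * \<beta> 0 x)"
        define J where "J = (LINT x|lborel. q (x / t) * \<beta> 1 x)"
        have split: "(LINT x|lborel. F (t, x)) = \<alpha> 1 t * I + \<alpha> 0 t * J"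
        proof -
          have "(LINT x|lborel. F (t, x)) =
              (LINT x|lborel. \<alpha> 1 t * (e (x / t) * \<beta> 0 x) + \<alpha> 0 t * (q (x / t) * \<beta> 1 x))"
            by (simp add: F_def mult_ac)
          also have "\<dots> = \<alpha> 1 t * I + \<alpha> 0 t * J"
            unfolding I_def J_def using I_int J_int by simp
          finally show ?thesis .
        qed
        \<comment> \<open>Cutoff and indicator of x at most 0 differ only left of -R, where
          \<open>e\<close> vanishes, and on an interval of length \<epsilon>, where \<open>e\<close>
          is at most C.\<close>
        have I_diff: "\<bar>I - t * M\<bar> \<le> C * \<epsilon>"
        proof -
          have "I - t * M = (LINT x|lborel. e (x / t) * \<beta> 0 x - e (x / t) * indicator {..0} x)"
            unfolding I_def M_scale(1)[OF t, symmetric] using I_int M_scale(2)[OF t] by simp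
          also have "\<bar>\<dots>\<bar> \<le> (LINT x|lborel. C * indicator {0..\<epsilon>} x)"
          proof (rule order_trans[OF integral_abs_bound integral_mono])
            show "integrable lborel (\<lambda>x. \<bar>e (x / t) * \<beta> 0 x - e (x / t) * indicator {..0} x\<bar>)"
              using I_int M_scale(2)[OF t] by simp
            show "integrable lborel (\<lambda>x. C * indicator {0..\<epsilon>} x)"
              by (intro integrable_mult_right integrable_real_indicator) (auto simp: emeasure_lborel_Icc_eq)
            fix x :: real
            consider "x < - R" | "- R \<le> x" "x < 0" | "0 \<le> x" "x \<le> \<epsilon>" | "x > \<epsilon>" by linarith
            then show "\<bar>e (x / t) * \<beta> 0 x - e (x / t) * indicator {..0} x\<bar> \<le> C * indicator {0..\<epsilon>} x"
            proof cases
              case 1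
              then show ?thesis using es[OF left[OF _ t, of x]] C by simp
            next
              case 2
              with \<epsilon> have "x / \<epsilon> \<le> 0" by (simp add: divide_nonpos_pos)
              with 2 show ?thesis using C by (simp add: \<beta>_def B_left B_right)
            next
              case 3
              have "\<beta> 0 x \<le> 1" using B_le_1[of "x + R + 1"] B_nonneg[of "x / \<epsilon>"] by (simp add: \<beta>_def)
              then have "\<bar>\<beta> 0 x - indicator {..0} x\<bar> \<le> 1"
                using \<beta>_nonneg[of x] by (simp add: indicator_def)
              then have "\<bar>e (x / t)\<bar> * \<bar>\<beta> 0 x - indicator {..0} x\<bar> \<le> C * 1"
                by (intro mult_mono eC C) auto
              with 3 show ?thesis by (simp add: abs_mult[symmetric] right_diff_distrib)
            next
              case 4
              then show ?thesis using \<epsilon> \<beta>z[of x] C by simp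
            qed
          qed
          also have "\<dots> = C * \<epsilon>" using \<epsilon> by simp
          finally show ?thesis .
        qed
        have J_le: "J \<le> - (L - \<eta>)"
        proof -
          \<comment> \<open>The falling edge of the cutoff is -b, and b is nonnegative with mass 1
            on the interval from 0 to \<epsilon>. Thus J is minus a weighted average of
            \<open>q\<close> near 0+.\<close>
          define b where "b x = B 1 (x / \<epsilon>) / \<epsilon>" for x
          have b: "integrable lborel b" "(LINT x|lborel. b x) = B 0 (\<epsilon> / \<epsilon>) - B 0 (0 / \<epsilon>)"
          proof -
            have d: "((\<lambda>x. B 0 (x / \<epsilon>)) has_real_derivative b x) (at x)" for x
              by (rule DERIV_cong[OF DERIV_chain'[OF _ B]])
                (use \<epsilon> in \<open>auto intro!: derivative_eq_intros simp: b_def\<close>)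
            have cB: "isCont (B 1) x" for x using B[of 1] DERIV_isCont by blast
            have "isCont (\<lambda>x. B 1 (x / \<epsilon>)) x" for x
              by (rule isCont_o2[OF _ cB]) (use \<epsilon> in \<open>auto intro!: continuous_intros\<close>)
            then have c: "isCont b x" for x
              unfolding b_def[abs_def] using \<epsilon> by (intro continuous_divide continuous_const) auto
            have z: "b x = 0" if "x \<notin> {0..\<epsilon>}" for x
              using Bz[of "x / \<epsilon>" 0] that \<epsilon> by (auto simp: b_def zero_le_divide_iff)
            show "integrable lborel b" "(LINT x|lborel. b x) = B 0 (\<epsilon> / \<epsilon>) - B 0 (0 / \<epsilon>)"
              using integral_derivative_compact_support[of "\<lambda>x. B 0 (x / \<epsilon>)" b 0 \<epsilon>] d c z \<epsilon> by auto
          qed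
          have "J \<le> (LINT x|lborel. - (L - \<eta>) * b x)"
            unfolding J_def
          proof (rule integral_mono_AE[OF J_int])
            show "integrable lborel (\<lambda>x. - (L - \<eta>) * b x)" using b by simp
            have "AE x in lborel. 0 < inverse t * x \<and> inverse t * x \<le> \<epsilon> \<longrightarrow> L - \<eta> \<le> q (inverse t * x)"
              by (rule AE_lborel_scale[OF qL]) (use t in auto)
            moreover have "AE x in lborel. x \<noteq> (0::real)" by (rule AE_lborel_singleton)
            ultimately show "AE x in lborel. q (x / t) * \<beta> 1 x \<le> - (L - \<eta>) * b x"
            proof eventually_elim
              case (elim x)
              consider "x \<le> - R" | "- R < x" "x < 0" | "0 < x" "x \<le> \<epsilon>" | "x > \<epsilon>"
                using elim by linarith
              then show ?case
              proof cases
                case 1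
                then have "x < 0" by (simp add: R_def)
                with \<epsilon> have "x / \<epsilon> < 0" by (simp add: divide_neg_pos)
                then have "b x = 0" using Bz[of "x / \<epsilon>" 0] by (simp add: b_def)
                then show ?thesis using qs[OF left[OF 1 t]] by simp
              next
                case 2
                with \<epsilon> have "x / \<epsilon> < 0" by (simp add: divide_neg_pos)
                then show ?thesis using Bz[of "x / \<epsilon>" 0] Bz[of "x + R + 1" 0] 2
                  by (simp add: b_def \<beta>_def)
              next
                case 3
                \<comment> \<open>As t is at least 1, dividing x by t stays within the range where
                  the lower bound for \<open>q\<close> is known.\<close>
                have "\<epsilon> * 1 \<le> \<epsilon> * t" using t \<epsilon> by (intro mult_left_mono) auto
                with 3 have "x \<le> \<epsilon> * t" by linarith
                then have "x / t \<le> \<epsilon>" using t by (simp add: pos_divide_le_eq)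
                with elim(1) 3 t have "L - \<eta> \<le> q (x / t)" by (simp add: divide_inverse mult.commute)
                then have "(L - \<eta>) * b x \<le> q (x / t) * b x"
                  using B1 \<epsilon> by (intro mult_right_mono) (simp_all add: b_def)
                moreover have "\<beta> 1 x = - b x"
                  using Bz[of "x + R + 1" 0] 3 by (simp add: \<beta>_def b_def R_def)
                ultimately show ?thesis by (simp add: algebra_simps)
              next
                case 4
                with \<epsilon> have "x / \<epsilon> > 1" by simp
                then show ?thesis using Bz[of "x / \<epsilon>" 0] Bz[of "x + R + 1" 0] 4 \<epsilon>
                  by (simp add: b_def \<beta>_def R_def)
              qed
            qed
          qed
          also have "\<dots> = - (L - \<eta>)" using b(2) \<epsilon> by (simp add: B_left B_right)
          finally show ?thesis .
        qed
        have "\<alpha> 1 t * (I - t * M) \<le> \<bar>\<alpha> 1 t\<bar> * (C * \<epsilon>)"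
        proof -
          have "\<alpha> 1 t * (I - t * M) \<le> \<bar>\<alpha> 1 t\<bar> * \<bar>I - t * M\<bar>"
            by (simp only: abs_mult[symmetric] abs_ge_self)
          also have "\<dots> \<le> \<bar>\<alpha> 1 t\<bar> * (C * \<epsilon>)" by (rule mult_left_mono[OF I_diff]) simp
          finally show ?thesis .
        qed
        moreover have "\<alpha> 0 t * J \<le> \<alpha> 0 t * (- (L - \<eta>))"
          by (rule mult_left_mono[OF J_le \<alpha>0])
        ultimately show ?thesis unfolding split by (simp add: algebra_simps)
      qed
    qed
    also have "\<dots> = - M + C * \<epsilon> * A - (L - \<eta>)"
      using \<alpha>_int[of 0] \<alpha>_int[of 1] t\<alpha>_int t\<alpha>_1 by (simp add: \<alpha>_1 A_def)
    finally show ?thesis using M0 by simp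
  qed

  have A0: "0 \<le> A" unfolding A_def by (intro integral_nonneg_AE) auto
  show ?thesis
  proof (rule field_le_epsilon)
    fix d :: real assume d: "d > 0"
    obtain \<delta> where \<delta>: "\<delta> > 0" "AE \<xi> in lborel. 0 < \<xi> \<and> \<xi> < \<delta> \<longrightarrow> L - d / 2 \<le> q \<xi>"
      using lim[of "d / 2"] d by auto
    \<comment> \<open>The first entry stays strictly below \<delta>; the second makes the error C
      \<epsilon> A at most d/2, with +1 guarding against C A = 0.\<close>
    define \<epsilon> where "\<epsilon> = min (\<delta> / 2) (d / (2 * (C * A + 1)))"
    have CA: "0 \<le> C * A" using C A0 by simp
    have \<epsilon>: "\<epsilon> > 0" using \<delta>(1) d CA by (simp add: \<epsilon>_def)
    have "\<epsilon> \<le> \<delta> / 2" unfolding \<epsilon>_def by (rule min.cobounded1)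
    with \<delta>(1) have "\<epsilon> < \<delta>" by simp
    then have "AE \<xi> in lborel. 0 < \<xi> \<and> \<xi> \<le> \<epsilon> \<longrightarrow> L - d / 2 \<le> q \<xi>"
      using \<delta>(2) by (auto elim!: eventually_mono)
    with key[of "d / 2" \<epsilon>] d \<epsilon> have "L \<le> d / 2 + C * \<epsilon> * A" by simp
    also have "C * \<epsilon> * A \<le> d / 2"
    proof -
      have "\<epsilon> * (C * A + 1) \<le> d / (2 * (C * A + 1)) * (C * A + 1)"
        using CA by (intro mult_right_mono) (auto simp: \<epsilon>_def)
      also have "\<dots> = d / 2" using CA by (simp add: field_simps)
      finally show ?thesis using \<epsilon> by (simp add: algebra_simps)
    qed
    finally show "L \<le> 0 + d" by simp
  qed
qed

subsection \<open>The boundary entropy inequality\<close>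

lemma AE_interval_imp_ex:
  fixes \<delta> :: real
  assumes "AE x in lborel. 0 < x \<and> x < \<delta> \<longrightarrow> P x" and "\<delta> > 0"
  shows "\<exists>x. 0 < x \<and> x < \<delta> \<and> P x"
proof (rule ccontr)
  assume contr: "\<not> ?thesis"
  from assms(1) have "AE x in lborel. x \<notin> {0<..<\<delta>}"
    by eventually_elim (use contr in auto)
  then have "{0<..<\<delta>} \<in> null_sets lborel"
    by (simp add: AE_iff_null_sets)
  with \<open>\<delta> > 0\<close> show False by (auto simp: null_sets_def)
qed

lemma has_trace_lborel:
  assumes "has_trace f U" and "\<epsilon> > 0"
  obtains \<delta> where "\<delta> > 0" and "AE x in lborel. 0 < x \<and> x < \<delta> \<longrightarrow> dist (f x) U < \<epsilon>"
  using assms by (auto simp: has_trace_def AE_completion_iff)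

lemma has_trace_unique:
  assumes "has_trace f U" and "has_trace f V"
  shows "U = V"
proof (rule ccontr)
  assume "U \<noteq> V"
  then have d: "dist U V / 2 > 0" by simp
  from has_trace_lborel[OF assms(1) d] obtain \<delta>1 where
    1: "\<delta>1 > 0" "AE x in lborel. 0 < x \<and> x < \<delta>1 \<longrightarrow> dist (f x) U < dist U V / 2" by blast
  from has_trace_lborel[OF assms(2) d] obtain \<delta>2 where
    2: "\<delta>2 > 0" "AE x in lborel. 0 < x \<and> x < \<delta>2 \<longrightarrow> dist (f x) V < dist U V / 2" by blast
  from 1(2) 2(2) have "AE x in lborel. 0 < x \<and> x < min \<delta>1 \<delta>2 \<longrightarrow>
      dist (f x) U < dist U V / 2 \<and> dist (f x) V < dist U V / 2"
    by eventually_elim auto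
  from AE_interval_imp_ex[OF this] 1(1) 2(1) obtain x where
    "dist (f x) U < dist U V / 2" "dist (f x) V < dist U V / 2" by auto
  then show False using dist_triangle_half_l[of U "f x" "dist U V" V] by (simp add: dist_commute)
qed

lemma trace0_eq: "has_trace f U \<Longrightarrow> trace0 f = U"
  unfolding trace0_def using has_trace_unique by blast

abbreviation half_plane :: "(real \<times> real) set" where
  "half_plane \<equiv> {0<..} \<times> UNIV"

lemma half_plane_sets: "half_plane \<in> sets borel"
  by (intro borel_open open_Times) auto

lemma half_plane_lebesgue: "half_plane \<in> sets lebesgue"
  using half_plane_sets by (simp add: sets_completionI_sets)

lemma AE_half_plane_iff:
  "(AE p in lebesgue_on half_plane. P p) \<longleftrightarrow> (AE p in lborel. 0 < fst p \<longrightarrow> P p)"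
  by (subst AE_restrict_space_iff)
    (use half_plane_lebesgue in \<open>auto simp: AE_completion_iff mem_Times_iff\<close>)

text \<open>Only (t, x) \<mapsto> w(x/t) is known to be measurable, and only in the Lebesgue sense,
  which is not inherited by slices. Its components are therefore replaced by Borel functions on the
  plane, which are then restricted to one good time.\<close>

lemma borel_profile_exists:
  assumes W: "weak_solution \<kappa> \<gamma> half_plane (\<lambda>(t, x). w (x / t))"
  obtains w' M where "w' \<in> borel_measurable borel"
    and "AE \<xi> in lborel. w \<xi> = w' \<xi> \<and> 0 \<le> fst (w \<xi>) \<and> norm (w \<xi>) \<le> M"
proof -
  define X where "X p = indicator half_plane p *\<^sub>R w (snd p / fst p)" for p
  have "(\<lambda>(t, x). w (x / t)) \<in> borel_measurable (lebesgue_on half_plane)"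
    using W by (simp add: weak_solution_def)
  then have X: "X \<in> borel_measurable lebesgue"
    unfolding X_def using half_plane_lebesgue
    by (subst (asm) borel_measurable_restrict_space_iff) (auto simp: split_beta)
  have "(\<lambda>p. fst (X p)) \<in> borel_measurable lebesgue" "(\<lambda>p. snd (X p)) \<in> borel_measurable lebesgue"
    by (rule measurable_compose[OF X borel_measurable_continuous_onI]; intro continuous_intros)+
  from this[THEN completion_ex_borel_measurable_real] obtain g1 g2
    where g: "g1 \<in> borel_measurable lborel" "AE p in lborel. fst (X p) = g1 p"
      "g2 \<in> borel_measurable lborel" "AE p in lborel. snd (X p) = g2 p"
    by blast
  obtain M where "AE p in lebesgue_on half_plane. norm (case p of (t, x) \<Rightarrow> w (x / t)) \<le> M"
    using W by (auto simp: weak_solution_def)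
  then have M: "AE p in lborel. 0 < fst p \<longrightarrow> norm (w (snd p / fst p)) \<le> M"
    by (simp add: AE_half_plane_iff split_beta)
  have "AE p in lebesgue_on half_plane. (case p of (t, x) \<Rightarrow> w (x / t)) \<in> state_space"
    using W by (simp add: weak_solution_def)
  then have st: "AE p in lborel. 0 < fst p \<longrightarrow> w (snd p / fst p) \<in> state_space"
    by (simp add: AE_half_plane_iff split_beta)
  have "AE p in lborel. 0 < fst p \<longrightarrow> w (snd p / fst p) = (g1 p, g2 p) \<and>
      0 \<le> fst (w (snd p / fst p)) \<and> norm (w (snd p / fst p)) \<le> M"
    using g(2,4) M st
  proof eventually_elim
    case (elim p)
    then show ?case
      by (auto simp: X_def state_space_def prod_eq_iff indicator_def mem_Times_iff split: if_splits)
  qed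
  then obtain t where t: "t > 0" "AE \<xi> in lborel. w (snd (t, t * \<xi>) / fst (t, t * \<xi>)) =
      (g1 (t, t * \<xi>), g2 (t, t * \<xi>)) \<and> 0 \<le> fst (w (snd (t, t * \<xi>) / fst (t, t * \<xi>))) \<and>
      norm (w (snd (t, t * \<xi>) / fst (t, t * \<xi>))) \<le> M"
    by (rule AE_half_plane_imp_ray)
  show ?thesis
  proof
    have [measurable]: "g1 \<in> borel_measurable (borel \<Otimes>\<^sub>M borel)" "g2 \<in> borel_measurable (borel \<Otimes>\<^sub>M borel)"
      using g by (auto simp: borel_prod)
    show "(\<lambda>\<xi>. (g1 (t, t * \<xi>), g2 (t, t * \<xi>))) \<in> borel_measurable borel" by measurable
    show "AE \<xi> in lborel. w \<xi> = (g1 (t, t * \<xi>), g2 (t, t * \<xi>)) \<and> 0 \<le> fst (w \<xi>) \<and> norm (w \<xi>) \<le> M"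
      using t by simp
  qed
qed

lemma product_test_function:
  assumes \<alpha>: "derivative_family \<alpha>" and \<beta>: "derivative_family \<beta>" and "0 < u"
    and z: "\<And>t. t \<notin> {u..v} \<Longrightarrow> \<alpha> 0 t = 0" "\<And>x. x \<notin> {u'..v'} \<Longrightarrow> \<beta> 0 x = 0"
  shows "test_function half_plane (\<lambda>i j p. \<alpha> i (fst p) * \<beta> j (snd p))"
proof -
  have "((\<lambda>p. \<alpha> i (fst p) * \<beta> j (snd p)) has_derivative
      (\<lambda>h. fst h * (\<alpha> (Suc i) (fst p) * \<beta> j (snd p)) + snd h * (\<alpha> i (fst p) * \<beta> (Suc j) (snd p)))) (at p)"
    for i j p
  proof -
    have "((\<lambda>p. \<alpha> i (fst p)) has_derivative (\<lambda>h. fst h * \<alpha> (Suc i) (fst p))) (at p)"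
      using has_derivative_compose[OF has_derivative_fst[OF has_derivative_ident]
          derivative_familyD[OF \<alpha>, unfolded has_field_derivative_def]]
      by (simp add: mult.commute)
    moreover have "((\<lambda>p. \<beta> j (snd p)) has_derivative (\<lambda>h. snd h * \<beta> (Suc j) (snd p))) (at p)"
      using has_derivative_compose[OF has_derivative_snd[OF has_derivative_ident]
          derivative_familyD[OF \<beta>, unfolded has_field_derivative_def]]
      by (simp add: mult.commute)
    ultimately show ?thesis
      by (rule has_derivative_mult[THEN has_derivative_eq_rhs]) (simp add: fun_eq_iff mult_ac)
  qed
  moreover have sub: "closure {p. \<alpha> 0 (fst p) * \<beta> 0 (snd p) \<noteq> 0} \<subseteq> {u..v} \<times> {u'..v'}"
  proof (rule closure_minimal)
    show "{p. \<alpha> 0 (fst p) * \<beta> 0 (snd p) \<noteq> 0} \<subseteq> {u..v} \<times> {u'..v'}"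
    proof
      fix p assume "p \<in> {p. \<alpha> 0 (fst p) * \<beta> 0 (snd p) \<noteq> 0}"
      with z(1)[of "fst p"] z(2)[of "snd p"] show "p \<in> {u..v} \<times> {u'..v'}"
        by (auto simp: mem_Times_iff)
    qed
  qed (intro closed_Times closed_atLeastAtMost)
  moreover have "compact (closure {p. \<alpha> 0 (fst p) * \<beta> 0 (snd p) \<noteq> 0})"
  proof -
    have "bounded ({u..v} \<times> {u'..v'})" by (intro bounded_Times compact_imp_bounded compact_Icc)
    then have "bounded {p. \<alpha> 0 (fst p) * \<beta> 0 (snd p) \<noteq> 0}"
      using sub closure_subset by (meson bounded_subset)
    then show ?thesis by (simp only: compact_closure)
  qed
  moreover have "{u..v} \<times> {u'..v'} \<subseteq> half_plane" using \<open>0 < u\<close> by auto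
  ultimately show ?thesis unfolding test_function_def by blast
qed

context gas
begin

text \<open>The constant is fixed before the right state and the profile, which allows one value for
  all edges. The passage to the relative pair (E, Q) adds only a multiple of the mass equation and a
  constant to the entropy inequality.\<close>

lemma boundary_entropy_inequality:
  assumes S: "convex_on UNIV S" "\<And>v. S v = S (- v)" and \<rho>s: "\<rho>s \<ge> 0"
  obtains c where "\<And>Ur w U. lax_solution \<kappa> \<gamma> (\<rho>s, 0) Ur w \<Longrightarrow> has_trace w U \<Longrightarrow>
    entropy_flux \<kappa> \<gamma> S U \<le> c * snd (conserved U)"
proof -
  have cS: "continuous_on UNIV S"
    by (rule convex_on_continuous) (use S in auto)
  obtain c where c: "\<And>U. fst U \<ge> 0 \<Longrightarrow>
      entropy \<kappa> \<gamma> S U \<ge> entropy \<kappa> \<gamma> S (\<rho>s, 0) + c * (fst U - \<rho>s)"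
    using entropy_tangent_at_rest[OF S \<rho>s] by blast
  define K where "K = entropy \<kappa> \<gamma> S (\<rho>s, 0) - c * \<rho>s"
  define \<eta> where "\<eta> = moment (\<lambda>(u, v). S v)"
  define G where "G = moment (\<lambda>(u, v). ((1 - \<theta>) * u + \<theta> * v) * S v)"
  have \<eta>: "entropy \<kappa> \<gamma> S U = \<eta> U" and G: "entropy_flux \<kappa> \<gamma> S U = G U" if "fst U \<ge> 0" for U
    using entropy_eq_moment[OF cS that] entropy_flux_eq_moment[OF cS that] by (simp_all add: \<eta>_def G_def)
  have cont: "continuous_on UNIV \<eta>" "continuous_on UNIV G"
    unfolding \<eta>_def G_def split_beta
    by (intro continuous_on_moment continuous_intros continuous_on_compose2[OF cS]; simp)+
  define E where "E U = \<eta> U - c * fst U - K" for U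
  define Q where "Q U = G U - c * (fst U * snd U)" for U
  have cE: "continuous_on UNIV E" and cQ: "continuous_on UNIV Q"
    unfolding E_def Q_def by (intro continuous_intros cont)+
  have E_nonneg: "0 \<le> E U" if "fst U \<ge> 0" for U
    using c[OF that] \<eta>[OF that] by (simp add: E_def K_def algebra_simps)

  have "entropy_flux \<kappa> \<gamma> S U \<le> c * snd (conserved U)"
    if lax: "lax_solution \<kappa> \<gamma> (\<rho>s, 0) Ur w" and tr: "has_trace w U" for Ur w U
  proof -
    have wes: "weak_entropy_solution \<kappa> \<gamma> half_plane (\<lambda>(t, x). w (x / t))"
      using lax by (simp add: lax_solution_def)
    then have ws: "weak_solution \<kappa> \<gamma> half_plane (\<lambda>(t, x). w (x / t))"
      by (simp add: weak_entropy_solution_def)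
    \<comment> \<open>The left edge of the 1-wave.\<close>
    obtain s where s: "\<And>\<xi>. \<xi> < s \<Longrightarrow> w \<xi> = (\<rho>s, 0)"
      using lax by (auto simp: lax_solution_def)
    obtain w' M where w'[measurable]: "w' \<in> borel_measurable borel"
      and w'_eq: "AE \<xi> in lborel. w \<xi> = w' \<xi> \<and> 0 \<le> fst (w \<xi>) \<and> norm (w \<xi>) \<le> M"
      using borel_profile_exists[OF ws] by blast
    \<comment> \<open>The profile is changed on a null set so that nonnegative density, boundedness
      and the constant left state hold at every \<xi>, as \<open>self_similar_flux_nonpos\<close>
      asks.\<close>
    define w1 where "w1 \<xi> = (if \<xi> \<in> {..<s} then (\<rho>s, 0) else
      if \<xi> \<in> w' -` ({0..} \<times> UNIV \<inter> cball 0 M) then w' \<xi> else (0, 0))" for \<xi>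
    have w1[measurable]: "w1 \<in> borel_measurable borel"
      unfolding w1_def
    proof (intro measurable_If_set measurable_const w')
      have "{0..} \<times> UNIV \<inter> cball 0 M \<in> sets (borel :: (real \<times> real) measure)"
        by (intro borel_closed closed_Int closed_Times) auto
      from measurable_sets[OF w' this]
      show "w' -` ({0..} \<times> UNIV \<inter> cball 0 M) \<inter> space borel \<in> sets borel" .
    qed auto
    have w1_eq: "AE \<xi> in lborel. w \<xi> = w1 \<xi>"
      using w'_eq by eventually_elim (auto simp: w1_def s mem_Times_iff)
    have w1_fst: "0 \<le> fst (w1 \<xi>)" for \<xi> using \<rho>s by (auto simp: w1_def mem_Times_iff)
    have w1_norm: "w1 \<xi> \<in> cball 0 (max \<bar>M\<bar> \<rho>s)" for \<xi> using \<rho>s by (auto simp: w1_def)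
    have bdd: "\<exists>C. \<forall>\<xi>. \<bar>f (w1 \<xi>)\<bar> \<le> C" if "continuous_on UNIV f" for f :: "real \<times> real \<Rightarrow> real"
    proof -
      have "bounded (f ` cball 0 (max \<bar>M\<bar> \<rho>s))"
        by (intro compact_imp_bounded compact_continuous_image continuous_on_subset[OF that]) auto
      then obtain C where "\<forall>x\<in>cball 0 (max \<bar>M\<bar> \<rho>s). norm (f x) \<le> C" by (auto simp: bounded_iff)
      with w1_norm show ?thesis by (metis real_norm_def)
    qed
    have meas: "(\<lambda>\<xi>. f (w1 \<xi>)) \<in> borel_measurable borel" if "continuous_on UNIV f" for f :: "real \<times> real \<Rightarrow> real"
      using measurable_compose[OF w1 borel_measurable_continuous_onI[OF that]] .
    have tr_eq: "\<exists>\<delta>>0. AE \<xi> in lborel. 0 < \<xi> \<and> \<xi> < \<delta> \<longrightarrow> dist (w1 \<xi>) U < \<epsilon>" if \<epsilon>: "\<epsilon> > 0" for \<epsilon>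
    proof -
      obtain \<delta> where "\<delta> > 0" "AE x in lborel. 0 < x \<and> x < \<delta> \<longrightarrow> dist (w x) U < \<epsilon>"
        using has_trace_lborel[OF tr \<epsilon>] by blast
      from this(2) w1_eq have "AE x in lborel. 0 < x \<and> x < \<delta> \<longrightarrow> dist (w1 x) U < \<epsilon>"
        by eventually_elim auto
      with \<open>\<delta> > 0\<close> show ?thesis by blast
    qed
    \<comment> \<open>The continuous extension \<open>G\<close> equals the entropy flux only for
      nonnegative density, so the trace must be placed there.\<close>
    have U: "0 \<le> fst U"
    proof (rule ccontr)
      assume "\<not> 0 \<le> fst U"
      with tr_eq[of "- fst U"] obtain \<delta> where
        "\<delta> > 0" "AE \<xi> in lborel. 0 < \<xi> \<and> \<xi> < \<delta> \<longrightarrow> dist (w1 \<xi>) U < - fst U" by auto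
      from AE_interval_imp_ex[OF this(2,1)] obtain \<xi> where "dist (w1 \<xi>) U < - fst U" by blast
      with dist_fst_le[of "w1 \<xi>" U] w1_fst[of \<xi>] show False by (simp add: dist_real_def)
    qed

    have weak: "0 \<le> (LINT p|lborel. E (w1 (snd p / fst p)) * (\<alpha> 1 (fst p) * \<beta> 0 (snd p)) +
        Q (w1 (snd p / fst p)) * (\<alpha> 0 (fst p) * \<beta> 1 (snd p)))"
      if \<alpha>: "derivative_family \<alpha>" and \<beta>: "derivative_family \<beta>"
        and nonneg: "\<And>t. 0 \<le> \<alpha> 0 t" "\<And>x. 0 \<le> \<beta> 0 x" and "0 < u"
        and z: "\<And>t. t \<notin> {u..v} \<Longrightarrow> \<alpha> 0 t = 0" "\<And>x. x \<notin> {u'..v'} \<Longrightarrow> \<beta> 0 x = 0"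
      for \<alpha> \<beta> u v u' v'
    proof -
      define \<phi> where "\<phi> i j p = \<alpha> i (fst p) * \<beta> j (snd p)" for i j and p :: "real \<times> real"
      have tf: "test_function half_plane \<phi>"
        unfolding \<phi>_def[abs_def] by (rule product_test_function[OF \<alpha> \<beta> \<open>0 < u\<close> z])
      have \<phi>_nonneg: "\<forall>p. 0 \<le> \<phi> 0 0 p" using nonneg by (simp add: \<phi>_def)
      have \<alpha>_int: "integrable lborel (\<alpha> n)" and \<beta>_int: "integrable lborel (\<beta> n)" for n
        using derivative_family_integrable[OF \<alpha> z(1)] derivative_family_integrable[OF \<beta> z(2)] by auto
      have \<phi>_int: "integrable lborel (\<phi> i j)" for i j
        unfolding \<phi>_def[abs_def] by (rule product_integrable[OF \<alpha>_int \<beta>_int])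
      have \<phi>_zero: "\<phi> i j p = 0" if "p \<notin> half_plane" for i j p
        using derivative_family_vanish[OF \<alpha> z(1), of u v "fst p" i] that \<open>0 < u\<close>
        by (auto simp: \<phi>_def mem_Times_iff)
      define V where "V p = w1 (snd p / fst p)" for p
      have V_meas: "(\<lambda>p. f (V p)) \<in> borel_measurable borel" if "continuous_on UNIV f"
        for f :: "real \<times> real \<Rightarrow> real"
        unfolding V_def borel_prod[symmetric] using meas[OF that] by measurable
      have int: "integrable lborel (\<lambda>p. f (V p) * \<phi> i j p)" if f: "continuous_on UNIV f"
        for f :: "real \<times> real \<Rightarrow> real" and i j
      proof -
        obtain C where "\<And>\<xi>. \<bar>f (w1 \<xi>)\<bar> \<le> C" using bdd[OF f] by blast
        then show ?thesis using V_meas[OF f]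
          by (intro integrable_bounded_times[where C = C] \<phi>_int) (auto simp: V_def)
      qed
      \<comment> \<open>Used for the entropy inequality and for the mass equation: the primed
        functions are the original ones, f and g their continuous versions on the whole
        plane.\<close>
      have transfer: "(LINT p|lebesgue_on half_plane. f' (case p of (t, x) \<Rightarrow> w (x / t)) * \<phi> 1 0 p +
          g' (case p of (t, x) \<Rightarrow> w (x / t)) * \<phi> 0 1 p) =
          (LINT p|lborel. f (V p) * \<phi> 1 0 p) + (LINT p|lborel. g (V p) * \<phi> 0 1 p)"
        if f: "continuous_on UNIV f" "\<And>U. 0 \<le> fst U \<Longrightarrow> f' U = f U"
          and g: "continuous_on UNIV g" "\<And>U. 0 \<le> fst U \<Longrightarrow> g' U = g U"
        for f g f' g' :: "real \<times> real \<Rightarrow> real"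
      proof -
        have "(LINT p|lebesgue_on half_plane. f' (case p of (t, x) \<Rightarrow> w (x / t)) * \<phi> 1 0 p +
            g' (case p of (t, x) \<Rightarrow> w (x / t)) * \<phi> 0 1 p) =
            (LINT p|lborel. f (V p) * \<phi> 1 0 p + g (V p) * \<phi> 0 1 p)"
        proof (rule integral_lebesgue_on_eq_lborel[OF half_plane_lebesgue])
          show "(\<lambda>p. f (V p) * \<phi> 1 0 p + g (V p) * \<phi> 0 1 p) \<in> borel_measurable borel"
            using borel_measurable_integrable[OF int[OF f(1)]]
              borel_measurable_integrable[OF int[OF g(1)]] by auto
          show "AE p in lborel. p \<in> half_plane \<longrightarrow>
              f' (case p of (t, x) \<Rightarrow> w (x / t)) * \<phi> 1 0 p +
              g' (case p of (t, x) \<Rightarrow> w (x / t)) * \<phi> 0 1 p =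
              f (V p) * \<phi> 1 0 p + g (V p) * \<phi> 0 1 p"
            using AE_ray_imp_half_plane[OF w1_eq]
            by eventually_elim (auto simp: V_def mem_Times_iff split_beta f(2) g(2) w1_fst)
        qed (simp add: \<phi>_zero)
        then show ?thesis using int[OF f(1)] int[OF g(1)] by simp
      qed
      have "0 \<le> (LINT p|lebesgue_on half_plane.
          entropy \<kappa> \<gamma> S (case p of (t, x) \<Rightarrow> w (x / t)) * \<phi> 1 0 p +
          entropy_flux \<kappa> \<gamma> S (case p of (t, x) \<Rightarrow> w (x / t)) * \<phi> 0 1 p)"
        using wes S(1) tf \<phi>_nonneg unfolding weak_entropy_solution_def by blast
      then have 1: "0 \<le> (LINT p|lborel. \<eta> (V p) * \<phi> 1 0 p) + (LINT p|lborel. G (V p) * \<phi> 0 1 p)"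
        by (subst (asm) transfer[OF cont(1) \<eta> cont(2) G]) auto
      have "(LINT p|lebesgue_on half_plane.
          fst (conserved (case p of (t, x) \<Rightarrow> w (x / t))) * \<phi> 1 0 p +
          snd (conserved (case p of (t, x) \<Rightarrow> w (x / t))) * \<phi> 0 1 p) = 0"
        using ws tf unfolding weak_solution_def by blast
      then have 2: "(LINT p|lborel. fst (V p) * \<phi> 1 0 p) + (LINT p|lborel. (fst (V p) * snd (V p)) * \<phi> 0 1 p) = 0"
        by (subst (asm) transfer[of fst _ "\<lambda>U. fst U * snd U"])
          (auto intro!: continuous_intros simp: conserved_def split_beta)
      \<comment> \<open>The constant \<open>K\<close> drops out, since a time derivative of a
        compactly supported function has integral zero.\<close>
      have 3: "(LINT p|lborel. \<phi> 1 0 p) = 0"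
      proof -
        have "integrable (lborel \<Otimes>\<^sub>M lborel) (\<phi> 1 0)" using \<phi>_int[of 1 0] by (simp add: lborel_prod)
        from lborel_pair.integral_fst'[OF this]
        have "(LINT p|lborel. \<phi> 1 0 p) = (LINT t|lborel. LINT x|lborel. \<phi> 1 0 (t, x))"
          by (simp add: lborel_prod)
        also have "\<dots> = (LINT t|lborel. \<alpha> 1 t) * (LINT x|lborel. \<beta> 0 x)" by (simp add: \<phi>_def)
        finally show ?thesis using integral_derivative_family_Suc[OF \<alpha> z(1), where n = 0] by simp
      qed
      have iE: "integrable lborel (\<lambda>p. \<eta> (V p) * \<phi> 1 0 p)" "integrable lborel (\<lambda>p. fst (V p) * \<phi> 1 0 p)"
        "integrable lborel (\<lambda>p. G (V p) * \<phi> 0 1 p)" "integrable lborel (\<lambda>p. (fst (V p) * snd (V p)) * \<phi> 0 1 p)"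
        by (intro int cont; auto intro!: int[of "\<lambda>U. fst U * snd U"] int[of fst] continuous_intros)+
      have "(LINT p|lborel. E (V p) * \<phi> 1 0 p + Q (V p) * \<phi> 0 1 p) =
          (LINT p|lborel. (\<eta> (V p) * \<phi> 1 0 p - c * (fst (V p) * \<phi> 1 0 p) - K * \<phi> 1 0 p) +
            (G (V p) * \<phi> 0 1 p - c * ((fst (V p) * snd (V p)) * \<phi> 0 1 p)))"
        by (intro Bochner_Integration.integral_cong refl) (simp add: E_def Q_def algebra_simps)
      also have "\<dots> = ((LINT p|lborel. \<eta> (V p) * \<phi> 1 0 p) + (LINT p|lborel. G (V p) * \<phi> 0 1 p)) -
          c * ((LINT p|lborel. fst (V p) * \<phi> 1 0 p) + (LINT p|lborel. (fst (V p) * snd (V p)) * \<phi> 0 1 p)) -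
          K * (LINT p|lborel. \<phi> 1 0 p)"
        using iE \<phi>_int[of 1 0] by (simp add: algebra_simps)
      finally show ?thesis using 1 unfolding 2 3 by (simp add: V_def \<phi>_def)
    qed

    obtain C1 C2 where C: "\<And>\<xi>. \<bar>E (w1 \<xi>)\<bar> \<le> C1" "\<And>\<xi>. \<bar>Q (w1 \<xi>)\<bar> \<le> C2"
      using bdd[OF cE] bdd[OF cQ] by blast
    have "Q U \<le> 0"
    proof (rule self_similar_flux_nonpos[where C = "max C1 C2" and s = s and
          e = "\<lambda>\<xi>. E (w1 \<xi>)" and q = "\<lambda>\<xi>. Q (w1 \<xi>)"])
      show "\<bar>E (w1 \<xi>)\<bar> \<le> max C1 C2" "\<bar>Q (w1 \<xi>)\<bar> \<le> max C1 C2" for \<xi>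
        using C[of \<xi>] by auto
      show "E (w1 \<xi>) = 0" "Q (w1 \<xi>) = 0" if "\<xi> < s" for \<xi>
        using that \<rho>s \<eta>[of "(\<rho>s, 0)"] G[of "(\<rho>s, 0)"] entropy_flux_at_rest[OF cS S(2) \<rho>s]
        by (simp_all add: w1_def E_def Q_def K_def)
      show "\<exists>\<delta>>0. AE \<xi> in lborel. 0 < \<xi> \<and> \<xi> < \<delta> \<longrightarrow> Q U - \<epsilon> \<le> Q (w1 \<xi>)" if \<epsilon>: "\<epsilon> > 0" for \<epsilon>
      proof -
        have "isCont Q U" using cQ continuous_on_eq_continuous_at[OF open_UNIV] by blast
        then obtain d where d: "d > 0" "\<And>V. dist V U < d \<Longrightarrow> dist (Q V) (Q U) < \<epsilon>"
          using \<epsilon> unfolding continuous_at_eps_delta by blast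
        obtain \<delta> where "\<delta> > 0" "AE \<xi> in lborel. 0 < \<xi> \<and> \<xi> < \<delta> \<longrightarrow> dist (w1 \<xi>) U < d"
          using tr_eq[OF d(1)] by blast
        from this(2) have "AE \<xi> in lborel. 0 < \<xi> \<and> \<xi> < \<delta> \<longrightarrow> Q U - \<epsilon> \<le> Q (w1 \<xi>)"
        proof eventually_elim
          case (elim \<xi>)
          then show ?case using d(2)[of "w1 \<xi>"] by (auto simp: dist_real_def)
        qed
        with \<open>\<delta> > 0\<close> show ?thesis by blast
      qed
    qed (rule meas[OF cE] meas[OF cQ] E_nonneg[OF w1_fst] | (rule weak; assumption))+
    then show ?thesis using G[OF U] by (simp add: Q_def conserved_def split_beta)
  qed
  with that show ?thesis by blast
qed

end

subsection \<open>The junction\<close>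

lemma tendsto_imp_has_trace:
  assumes "(w \<longlongrightarrow> U) (at_right 0)"
  shows "has_trace w U"
  unfolding has_trace_def
proof (intro allI impI)
  fix \<epsilon> :: real assume "\<epsilon> > 0"
  with assms have "eventually (\<lambda>x. dist (w x) U < \<epsilon>) (at_right 0)" by (rule tendstoD)
  then obtain \<delta> where "\<delta> > 0" "\<forall>x>0. x < \<delta> \<longrightarrow> dist (w x) U < \<epsilon>"
    by (auto simp: eventually_at_right_field)
  then show "\<exists>\<delta>>0. AE x in lebesgue. 0 < x \<and> x < \<delta> \<longrightarrow> dist (w x) U < \<epsilon>"
    by (intro exI[of _ \<delta>]) (auto intro!: AE_I2)
qed

lemma has_trace_scale:
  assumes "has_trace w U" and "t > 0" and f: "\<And>x. x > 0 \<Longrightarrow> f x = w (x / t)"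
  shows "has_trace f U"
  unfolding has_trace_def
proof (intro allI impI)
  fix \<epsilon> :: real assume \<epsilon>: "\<epsilon> > 0"
  obtain \<delta> where \<delta>: "\<delta> > 0" "AE x in lborel. 0 < x \<and> x < \<delta> \<longrightarrow> dist (w x) U < \<epsilon>"
    using has_trace_lborel[OF assms(1) \<epsilon>] by blast
  have "AE x in lborel. 0 < inverse t * x \<and> inverse t * x < \<delta> \<longrightarrow> dist (w (inverse t * x)) U < \<epsilon>"
    by (rule AE_lborel_scale[OF \<delta>(2)]) (use \<open>t > 0\<close> in simp)
  then have "AE x in lborel. 0 < x \<and> x < \<delta> * t \<longrightarrow> dist (f x) U < \<epsilon>"
    by eventually_elim (use \<open>t > 0\<close> f in \<open>auto simp: field_simps\<close>)
  then show "\<exists>\<delta>>0. AE x in lebesgue. 0 < x \<and> x < \<delta> \<longrightarrow> dist (f x) U < \<epsilon>"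
    using \<delta>(1) \<open>t > 0\<close> by (intro exI[of _ "\<delta> * t"]) (auto intro!: AE_completion)
qed

context gas
begin

text \<open>\<open>\<sigma> = 1\<close> is a 1-fan and \<open>\<sigma> = -1\<close> a 2-fan: the Riemann invariant \<open>Z\<close> and the eigenvalue
  \<open>\<xi>\<close> determine the state.\<close>

lemma fan_converges:
  assumes c: "c > 0" and \<sigma>: "\<sigma> \<in> {-1, 1}"
    and fan: "\<forall>\<^sub>F \<xi> in at_right 0. fst (w \<xi>) > 0 \<and>
      snd (w \<xi>) + \<sigma> * (a * fst (w \<xi>) powr \<theta>) = Z \<and>
      snd (w \<xi>) - \<sigma> * (c * fst (w \<xi>) powr \<theta>) = \<xi>"
  shows "\<exists>U. (w \<longlongrightarrow> U) (at_right 0)"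
proof -
  have ac: "a + c > 0" using a_pos c by simp
  \<comment> \<open>Eliminating the velocity from the two equations of the fan gives \<rho>^\<theta>
    as this affine function of \<xi>.\<close>
  define r where "r \<xi> = \<sigma> * (Z - \<xi>) / (a + c)" for \<xi>
  have r: "(r \<longlongrightarrow> r 0) (at_right 0)"
    unfolding r_def by (intro tendsto_intros) (use ac in auto)
  have fan': "\<forall>\<^sub>F \<xi> in at_right 0. 0 < r \<xi> \<and> w \<xi> = (r \<xi> powr (1 / \<theta>), Z - \<sigma> * (a * r \<xi>))"
    using fan
  proof eventually_elim
    case (elim \<xi>)
    have "\<sigma> * (Z - \<xi>) = \<sigma> * \<sigma> * ((a + c) * fst (w \<xi>) powr \<theta>)"
      using elim by (auto simp: algebra_simps)
    also have "\<sigma> * \<sigma> = 1" using \<sigma> by auto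
    finally have "r \<xi> = fst (w \<xi>) powr \<theta>" using ac by (simp add: r_def)
    moreover from this have "r \<xi> powr (1 / \<theta>) = fst (w \<xi>)"
      using elim theta_pos by (simp add: powr_powr)
    ultimately show ?case using elim by (auto simp: prod_eq_iff)
  qed
  \<comment> \<open>A 2-fan that starts from vacuum at \<xi> = 0 has r 0 = 0, so continuity of the
    power at 0 is used, from nonnegative arguments and with a positive exponent.\<close>
  then have "\<forall>\<^sub>F \<xi> in at_right 0. 0 \<le> r \<xi>" by eventually_elim simp
  then have "((\<lambda>\<xi>. (r \<xi> powr (1 / \<theta>), Z - \<sigma> * (a * r \<xi>))) \<longlongrightarrow>
      (r 0 powr (1 / \<theta>), Z - \<sigma> * (a * r 0))) (at_right 0)"
    using r theta_pos by (intro tendsto_Pair tendsto_intros tendsto_powr2) auto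
  then have "(w \<longlongrightarrow> (r 0 powr (1 / \<theta>), Z - \<sigma> * (a * r 0))) (at_right 0)"
    by (rule Lim_transform_eventually) (use fan' in \<open>auto elim!: eventually_mono\<close>)
  then show ?thesis by blast
qed

lemma sound_speed_factor_pos: "sqrt (\<kappa> * \<gamma>) > 0"
  using kappa_pos gamma_gt_1 by simp

text \<open>The Riemann problem does not postulate traces, and \<open>trace0\<close> is a definite
  description that says nothing without existence.\<close>

lemma lax_solution_has_trace:
  assumes "lax_solution \<kappa> \<gamma> Ul Ur w"
  shows "\<exists>U. has_trace w U"
proof -
  obtain Um s1 s1' s2 s2' where ord: "s1 \<le> s1'" "s1' \<le> s2" "s2 \<le> s2'"
    and w1: "wave1 \<kappa> \<gamma> Ul Um s1 s1' w" and w2: "wave2 \<kappa> \<gamma> Um Ur s2 s2' w"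
    and const: "\<And>\<xi>. \<xi> < s1 \<Longrightarrow> w \<xi> = Ul" "\<And>\<xi>. s1' < \<xi> \<Longrightarrow> \<xi> < s2 \<Longrightarrow> w \<xi> = Um"
      "\<And>\<xi>. s2' < \<xi> \<Longrightarrow> w \<xi> = Ur"
    using assms by (auto simp: lax_solution_def)
  have between: "\<forall>\<^sub>F \<xi> in at_right 0. p < \<xi> \<and> \<xi> < q" if "p \<le> 0" "0 < q" for p q :: real
    using that by (auto simp: eventually_at_right_field intro!: exI[of _ q])
  have "\<exists>U. (w \<longlongrightarrow> U) (at_right 0)"
  proof -
    \<comment> \<open>The limit is taken from the right, so each sector counts its left edge at 0
      and not its right edge. A wave containing 0+ then has positive width, which excludes shocks
      and waves of zero strength.\<close>
    consider "0 < s1" | "s1 \<le> 0" "0 < s1'" | "s1' \<le> 0" "0 < s2" | "s2 \<le> 0" "0 < s2'" | "s2' \<le> 0"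
      by linarith
    then show ?thesis
    proof cases
      case 1
      have "\<forall>\<^sub>F \<xi> in at_right 0. w \<xi> = Ul"
        using between[of "-1" s1] 1 const(1) by (auto elim!: eventually_mono)
      then show ?thesis by (blast intro: tendsto_eventually)
    next
      case 2
      with w1 have "rarefaction1 \<kappa> \<gamma> Ul Um s1 s1' w" by (auto simp: wave1_def)
      then obtain Z where Z: "\<And>\<xi>. s1 < \<xi> \<Longrightarrow> \<xi> < s1' \<Longrightarrow> fst (w \<xi>) > 0 \<and>
          snd (w \<xi>) + a * fst (w \<xi>) powr \<theta> = Z \<and> eigenvalue1 \<kappa> \<gamma> (w \<xi>) = \<xi>"
        unfolding rarefaction1_def by (fastforce simp: Let_def split_beta)
      show ?thesis
        by (rule fan_converges[OF sound_speed_factor_pos, of 1 w Z])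
          (use between[OF 2] Z in \<open>auto elim!: eventually_mono simp: eigenvalue1_def split_beta\<close>)
    next
      case 3
      have "\<forall>\<^sub>F \<xi> in at_right 0. w \<xi> = Um"
        using between[OF 3] const(2) by (auto elim!: eventually_mono)
      then show ?thesis by (blast intro: tendsto_eventually)
    next
      case 4
      with w2 have "rarefaction2 \<kappa> \<gamma> Um Ur s2 s2' w" by (auto simp: wave2_def)
      then obtain Z where Z: "\<And>\<xi>. s2 < \<xi> \<Longrightarrow> \<xi> < s2' \<Longrightarrow> fst (w \<xi>) > 0 \<and>
          snd (w \<xi>) - a * fst (w \<xi>) powr \<theta> = Z \<and> eigenvalue2 \<kappa> \<gamma> (w \<xi>) = \<xi>"
        unfolding rarefaction2_def by (fastforce simp: Let_def split_beta)
      show ?thesis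
        by (rule fan_converges[OF sound_speed_factor_pos, of "-1" w Z])
          (use between[OF 4] Z in \<open>auto elim!: eventually_mono simp: eigenvalue2_def split_beta\<close>)
    next
      case 5
      have "\<forall>\<^sub>F \<xi> in at_right 0. w \<xi> = Ur"
        using between[OF 5, of 1] const(3) by (auto elim!: eventually_mono)
      then show ?thesis by (blast intro: tendsto_eventually)
    qed
  qed
  then show ?thesis using tendsto_imp_has_trace by blast
qed

text \<open>The common core of both problems: each edge supplies some Lax solution issuing from the
  same state at rest, with the junction state as its trace.\<close>

lemma junction_entropy_inequality:
  assumes A: "\<And>k. k \<in> {1..d} \<Longrightarrow> 0 < A k" and \<rho>s: "0 \<le> \<rho>s"
    and lax: "\<And>k. k \<in> {1..d} \<Longrightarrow> \<exists>Ur w. lax_solution \<kappa> \<gamma> (\<rho>s, 0) Ur w \<and> has_trace w (V k)"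
    and mass: "(\<Sum>k=1..d. A k * snd (conserved (V k))) = 0"
    and S: "convex_on UNIV S" "\<And>v. S v = S (- v)"
  shows "(\<Sum>k=1..d. A k * entropy_flux \<kappa> \<gamma> S (V k)) \<le> 0"
proof -
  obtain c where c: "\<And>Ur w U. lax_solution \<kappa> \<gamma> (\<rho>s, 0) Ur w \<Longrightarrow> has_trace w U \<Longrightarrow>
      entropy_flux \<kappa> \<gamma> S U \<le> c * snd (conserved U)"
    using boundary_entropy_inequality[OF S \<rho>s] by blast
  have "(\<Sum>k=1..d. A k * entropy_flux \<kappa> \<gamma> S (V k)) \<le> (\<Sum>k=1..d. A k * (c * snd (conserved (V k))))"
  proof (rule sum_mono)
    fix k assume k: "k \<in> {1..d}"
    with lax obtain Ur w where "lax_solution \<kappa> \<gamma> (\<rho>s, 0) Ur w" "has_trace w (V k)" by blast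
    from c[OF this] A[OF k]
    show "A k * entropy_flux \<kappa> \<gamma> S (V k) \<le> A k * (c * snd (conserved (V k)))"
      by (intro mult_left_mono) auto
  qed
  also have "\<dots> = c * (\<Sum>k=1..d. A k * snd (conserved (V k)))"
    by (simp add: sum_distrib_left mult_ac)
  finally show ?thesis by (simp add: mass)
qed

end

theorem proposition4:
  fixes \<kappa> \<gamma> :: real and d :: nat and A :: "nat \<Rightarrow> real"
  assumes "\<kappa> > 0" and "1 < \<gamma>" and "\<gamma> < 3" and "\<And>k. k \<in> {1..d} \<Longrightarrow> A k > 0"
  shows "(\<forall>(Uh :: nat \<Rightarrow> real \<times> real) (U :: nat \<Rightarrow> real \<Rightarrow> real \<Rightarrow> real \<times> real).
            (\<forall>k\<in>{1..d}. Uh k \<in> state_space) \<and> generalized_riemann_solution \<kappa> \<gamma> d A Uh U \<longrightarrow>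
            (AE t in lebesgue. 0 < t \<longrightarrow>
               (\<forall>S :: real \<Rightarrow> real. convex_on UNIV S \<and> (\<forall>v. S v = S (- v)) \<longrightarrow>
                  (\<Sum>k=1..d. A k * entropy_flux \<kappa> \<gamma> S (trace0 (U k t))) \<le> 0))) \<and>
         (\<forall>(U0 :: nat \<Rightarrow> real \<times> real) (T :: ereal) (Uh :: nat \<Rightarrow> real \<Rightarrow> real \<times> real)
            (U :: nat \<Rightarrow> real \<Rightarrow> real \<Rightarrow> real \<times> real).
            0 < T \<and> cauchy_data d U0 Uh \<and> generalized_cauchy_solution \<kappa> \<gamma> d A U0 T Uh U \<longrightarrow>
            (AE t in lebesgue. 0 < t \<and> ereal t < T \<longrightarrow>
               (\<forall>S :: real \<Rightarrow> real. convex_on UNIV S \<and> (\<forall>v. S v = S (- v)) \<longrightarrow>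
                  (\<Sum>k=1..d. A k * entropy_flux \<kappa> \<gamma> S (trace0 (U k t))) \<le> 0)))"
proof (intro conjI allI impI)
  interpret gas \<kappa> \<gamma> using assms by unfold_locales
  note A = assms(4)
  {
    fix Uh :: "nat \<Rightarrow> real \<times> real" and U :: "nat \<Rightarrow> real \<Rightarrow> real \<Rightarrow> real \<times> real"
    assume "(\<forall>k\<in>{1..d}. Uh k \<in> state_space) \<and> generalized_riemann_solution \<kappa> \<gamma> d A Uh U"
    then have sol: "generalized_riemann_solution \<kappa> \<gamma> d A Uh U" ..
    then obtain \<rho>s where \<rho>s: "\<rho>s \<ge> 0" and edge: "\<And>k. k \<in> {1..d} \<Longrightarrow>
        \<exists>w. lax_solution \<kappa> \<gamma> (\<rho>s, 0) (Uh k) w \<and> (\<forall>t>0. \<forall>x>0. U k t x = w (x / t))"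
      unfolding generalized_riemann_solution_def by blast
    have mass: "(\<Sum>k=1..d. A k * snd (conserved (trace0 (U k t)))) = 0" if "t > 0" for t
      using sol that unfolding generalized_riemann_solution_def by blast
    show "AE t in lebesgue. 0 < t \<longrightarrow>
        (\<forall>S :: real \<Rightarrow> real. convex_on UNIV S \<and> (\<forall>v. S v = S (- v)) \<longrightarrow>
          (\<Sum>k=1..d. A k * entropy_flux \<kappa> \<gamma> S (trace0 (U k t))) \<le> 0)"
    proof (intro AE_I2 impI allI)
      fix t :: real and S :: "real \<Rightarrow> real"
      assume t: "0 < t" and S: "convex_on UNIV S \<and> (\<forall>v. S v = S (- v))"
      show "(\<Sum>k=1..d. A k * entropy_flux \<kappa> \<gamma> S (trace0 (U k t))) \<le> 0"
      proof (rule junction_entropy_inequality[OF A \<rho>s _ mass[OF t]])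
        fix k assume "k \<in> {1..d}"
        then obtain w where w: "lax_solution \<kappa> \<gamma> (\<rho>s, 0) (Uh k) w" "\<And>x. x > 0 \<Longrightarrow> U k t x = w (x / t)"
          using edge t by blast
        obtain V where V: "has_trace w V" using lax_solution_has_trace[OF w(1)] by blast
        \<comment> \<open>For fixed t the edge is the profile stretched by t, which leaves the limit
          at 0+ unchanged.\<close>
        have "trace0 (U k t) = V" by (rule trace0_eq[OF has_trace_scale[OF V t w(2)]])
        with w(1) V show "\<exists>Ur w. lax_solution \<kappa> \<gamma> (\<rho>s, 0) Ur w \<and> has_trace w (trace0 (U k t))"
          by blast
      qed (use S in auto)
    qed
  next
    fix U0 :: "nat \<Rightarrow> real \<times> real" and T :: ereal and Uh :: "nat \<Rightarrow> real \<Rightarrow> real \<times> real"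
      and U :: "nat \<Rightarrow> real \<Rightarrow> real \<Rightarrow> real \<times> real"
    assume "0 < T \<and> cauchy_data d U0 Uh \<and> generalized_cauchy_solution \<kappa> \<gamma> d A U0 T Uh U"
    then have sol: "generalized_cauchy_solution \<kappa> \<gamma> d A U0 T Uh U" by simp
    have "AE t in lebesgue. 0 < t \<and> ereal t < T \<longrightarrow>
        (\<exists>\<rho>s\<ge>0. \<forall>k\<in>{1..d}. trace0 (U k t) \<in> boundary_states \<kappa> \<gamma> (\<rho>s, 0))"
      using sol unfolding generalized_cauchy_solution_def Let_def by (auto elim!: eventually_mono)
    moreover have "AE t in lebesgue. 0 < t \<and> ereal t < T \<longrightarrow>
        (\<Sum>k=1..d. A k * snd (conserved (trace0 (U k t)))) = 0"
      using sol unfolding generalized_cauchy_solution_def Let_def by blast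
    ultimately show "AE t in lebesgue. 0 < t \<and> ereal t < T \<longrightarrow>
        (\<forall>S :: real \<Rightarrow> real. convex_on UNIV S \<and> (\<forall>v. S v = S (- v)) \<longrightarrow>
          (\<Sum>k=1..d. A k * entropy_flux \<kappa> \<gamma> S (trace0 (U k t))) \<le> 0)"
    \<comment> \<open>The exceptional times come from the coupling conditions alone, so one null set
      serves every \<open>S\<close>.\<close>
    proof eventually_elim
      case (elim t)
      show ?case
      proof (intro impI allI)
        fix S :: "real \<Rightarrow> real"
        assume t: "0 < t \<and> ereal t < T" and S: "convex_on UNIV S \<and> (\<forall>v. S v = S (- v))"
        from elim(1) t obtain \<rho>s where \<rho>s: "\<rho>s \<ge> 0"
          and V: "\<And>k. k \<in> {1..d} \<Longrightarrow> trace0 (U k t) \<in> boundary_states \<kappa> \<gamma> (\<rho>s, 0)" by blast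
        from elim(2) t have mass: "(\<Sum>k=1..d. A k * snd (conserved (trace0 (U k t)))) = 0" by blast
        have lax: "\<exists>Ur w. lax_solution \<kappa> \<gamma> (\<rho>s, 0) Ur w \<and> has_trace w (trace0 (U k t))"
          if "k \<in> {1..d}" for k
          using V[OF that] unfolding boundary_states_def by blast
        show "(\<Sum>k=1..d. A k * entropy_flux \<kappa> \<gamma> S (trace0 (U k t))) \<le> 0"
          by (rule junction_entropy_inequality[OF A \<rho>s lax mass]) (use S in auto)
      qed
    qed
  }
qed

end
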